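(* There is an instance of edge-weighted online stochastic matching without free disposal such that every online algorithm, even computationally unbounded, has expected objective less than $0.703$ times the expected weight of the maximum-weight matching of the realized bipartite graph. That is, no algorithm is $0.703$-competitive.
   Context: Online stochastic matching model: $I$ is a finite set of online types and $J$ a finite set of offline vertices, with edges $E\subseteq I\times J$ and weights $w_{ij}>0$. There are $\Lambda$ online vertices (an integer), arriving one at a time. Each independently has type $i$ with probability $\lambda_i/\Lambda$, where $\sum_i\lambda_i=\Lambda$. The asymptotically equivalent Poisson arrival model instead has type $i$ arrive by an independent Poisson process of rate $\lambda_i$ on $[0,1]$. Upon arrival, the algorithm knows $I,J,E,w,\lambda$ and must immediately and irrevocably match the vertex to an unmatched offline neighbor or leave it unmatched. Without free disposal, each offline vertex can be matched at most once. The objective is the total weight of matched edges. *)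

theory Defs
  imports "HOL-Probability.Probability"
begin

text \<open>Online stochastic matching without free disposal (integer-arrival model).
  Online types and offline vertices are natural numbers; an instance consists of
  finite sets I (online types) and J (offline vertices), edges E \<subseteq> I \<times> J,
  positive weights w on E, arrival rates lam i > 0 with sum Lambda (a positive integer).\<close>

type_synonym history = "(nat \<times> nat option) list"
  \<comment> \<open>past arrivals: (type of the online vertex, offline vertex it was matched to, if any)\<close>

type_synonym online_alg = "history \<Rightarrow> nat \<Rightarrow> nat option pmf"
  \<comment> \<open>a (randomized, computationally unbounded) online algorithm: given the full history and
      the type of the newly arrived vertex, a distribution over decisions (None = leave unmatched)\<close>

definition matched_offline :: "history \<Rightarrow> nat set" where
  "matched_offline h = {j. \<exists>i. (i, Some j) \<in> set h}"

definition valid_alg :: "(nat \<times> nat) set \<Rightarrow> online_alg \<Rightarrow> bool" where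
  "valid_alg E A \<longleftrightarrow>
     (\<forall>h i. set_pmf (A h i) \<subseteq> insert None (Some ` {j. (i, j) \<in> E \<and> j \<notin> matched_offline h}))"

definition valid_instance ::
  "nat set \<Rightarrow> nat set \<Rightarrow> (nat \<times> nat) set \<Rightarrow> (nat \<Rightarrow> nat \<Rightarrow> real) \<Rightarrow> (nat \<Rightarrow> real) \<Rightarrow> nat \<Rightarrow> bool" where
  "valid_instance I J E w lam Lambda \<longleftrightarrow>
     finite I \<and> finite J \<and> E \<subseteq> I \<times> J \<and> (\<forall>(i, j) \<in> E. w i j > 0) \<and>
     (\<forall>i\<in>I. lam i > 0) \<and> (\<Sum>i\<in>I. lam i) = real Lambda \<and> Lambda > 0"

definition arrival_pmf :: "nat set \<Rightarrow> (nat \<Rightarrow> real) \<Rightarrow> nat \<Rightarrow> nat pmf" where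
  "arrival_pmf I lam Lambda = embed_pmf (\<lambda>i. if i \<in> I then lam i / real Lambda else 0)"

primrec run :: "online_alg \<Rightarrow> nat pmf \<Rightarrow> nat \<Rightarrow> history \<Rightarrow> history pmf" where
  "run A p 0 h = return_pmf h"
| "run A p (Suc n) h =
     bind_pmf p (\<lambda>i. bind_pmf (A h i) (\<lambda>d. run A p n (h @ [(i, d)])))"

definition alg_gain :: "(nat \<Rightarrow> nat \<Rightarrow> real) \<Rightarrow> history \<Rightarrow> real" where
  "alg_gain w h = sum_list (map (\<lambda>(i, d). case d of None \<Rightarrow> 0 | Some j \<Rightarrow> w i j) h)"

primrec types_pmf :: "nat pmf \<Rightarrow> nat \<Rightarrow> nat list pmf" where
  "types_pmf p 0 = return_pmf []"
| "types_pmf p (Suc n) = bind_pmf p (\<lambda>i. map_pmf (\<lambda>ts. i # ts) (types_pmf p n))"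

text \<open>Matchings of the realized bipartite graph: online vertex k (of type ts!k) to offline j.\<close>
definition is_matching :: "(nat \<times> nat) set \<Rightarrow> nat list \<Rightarrow> (nat \<times> nat) set \<Rightarrow> bool" where
  "is_matching E ts M \<longleftrightarrow>
     M \<subseteq> {(k, j). k < length ts \<and> (ts ! k, j) \<in> E} \<and>
     (\<forall>(k, j) \<in> M. \<forall>(k', j') \<in> M. (k = k' \<longleftrightarrow> j = j'))"

definition opt_val :: "(nat \<times> nat) set \<Rightarrow> (nat \<Rightarrow> nat \<Rightarrow> real) \<Rightarrow> nat list \<Rightarrow> real" where
  "opt_val E w ts = Max {(\<Sum>(k, j)\<in>M. w (ts ! k) j) | M. is_matching E ts M}"

end

theory Submission
  imports Defs
begin

text \<open>There are \<open>n\<close> offline vertices and \<open>2n\<close> arrivals. Per offline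
    vertex the expected numbers of
  arrivals are: \<open>10\<^sup>-\<^sup>5\<close> private ones of weight \<open>10\<^sup>5\<close>,
      \<open>1/4\<close> private ones of weight \<open>6/5\<close>, \<open>3/5\<close> ones of
  weight \<open>1\<close> adjacent to three random vertices, and \<open>0.198\<close> ones of weight
      \<open>1\<close> adjacent to all vertices.

  Offline, almost every vertex is matched, as far as possible to its rare or else to its private
  arrival, which gives at least \<open>2.0441 n\<close>. This needs that the private and the triple arrivals
  leave fewer than \<open>0.198 n\<close> vertices unmatched. By Hall's theorem their number is
  \<open>max\<^sub>S (|S| - |N(S)|)\<close>. A private arrival lowers it with probability
      \<open>y\<close> and a triple one with
  probability \<open>1 - (1 - y)\<^sup>3\<close>, where \<open>y n\<close> is the size of the least
      maximiser \<open>S\<close>. In the limit the mean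
  \<open>T(r, \<rho>)\<close> therefore solves the Hamilton--Jacobi equation \<open>T\<^sub>\<rho> = (1 +
      T\<^sub>r)\<^sup>3 - 1\<close> with \<open>T(r, 0) = e\<^sup>-\<^sup>r\<close>, whose
  solution is given by Hopf's formula.

  Online, the value of \<open>m\<close> free vertices with a fraction \<open>s\<close> of the time left
      is at most
  \<open>m a(s) + n b(s)\<close>: the concave probability that a triple hits a free vertex is replaced by a
  tangent, and \<open>a\<close> and \<open>b\<close> are explicit supersolutions of the resulting
      differential equations. This
  gives at most \<open>1.4366 n\<close>.\<close>

section \<open>Expectations over finite products\<close>

abbreviation expect :: "'a pmf \<Rightarrow> ('a \<Rightarrow> real) \<Rightarrow> real" where
  "expect p f \<equiv> measure_pmf.expectation p f"

lemma expect_eq_sum: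
  assumes "finite (set_pmf p)"
  shows "expect p f = (\<Sum>x\<in>set_pmf p. pmf p x * f x)"
  using integral_measure_pmf[OF assms, of p f] by simp

lemma expect_mono:
  assumes "finite (set_pmf p)" "\<And>x. x \<in> set_pmf p \<Longrightarrow> f x \<le> g x"
  shows "expect p f \<le> expect p g"
  using assms by (simp add: expect_eq_sum sum_mono mult_left_mono)

lemma expect_add:
  assumes "finite (set_pmf p)"
  shows "expect p (\<lambda>x. f x + g x) = expect p f + expect p g"
  using assms by (simp add: expect_eq_sum sum.distrib algebra_simps)

lemma expect_diff:
  assumes "finite (set_pmf p)"
  shows "expect p (\<lambda>x. f x - g x) = expect p f - expect p g"
  using assms by (simp add: expect_eq_sum sum_subtractf algebra_simps)

lemma expect_cmult: "expect p (\<lambda>x. c * f x) = c * expect p f"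
  by simp

lemma expect_const: "expect p (\<lambda>_. c) = c"
  by simp

lemma expect_sum:
  assumes "finite (set_pmf p)"
  shows "expect p (\<lambda>x. \<Sum>i\<in>A. f i x) = (\<Sum>i\<in>A. expect p (f i))"
  using assms by (intro Bochner_Integration.integral_sum) (auto intro: integrable_measure_pmf_finite)

lemma expect_swap:
  assumes "finite (set_pmf p)" "finite (set_pmf q)"
  shows "expect p (\<lambda>x. expect q (f x)) = expect q (\<lambda>y. expect p (\<lambda>x. f x y))"
  using assms sum.swap[of "\<lambda>x y. pmf p x * (pmf q y * f x y)" "set_pmf q" "set_pmf p"]
  by (simp add: expect_eq_sum sum_distrib_left algebra_simps)

lemma expect_bind:
  assumes "finite (set_pmf p)" "\<And>x. x \<in> set_pmf p \<Longrightarrow> finite (set_pmf (q x))"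
  shows "expect (bind_pmf p q) f = expect p (\<lambda>x. expect (q x) f)"
  using pmf_expectation_bind[OF assms(1) assms(2) order_refl, where h = f] assms(1)
  by (simp add: expect_eq_sum)

section \<open>Independent lists, with a separate distribution for each entry\<close>

primrec list_pmf :: "'a pmf list \<Rightarrow> 'a list pmf" where
  "list_pmf [] = return_pmf []"
| "list_pmf (p # ps) = bind_pmf p (\<lambda>x. map_pmf (Cons x) (list_pmf ps))"

text \<open>Finite supports make every real function integrable, so linearity and the exchange of
  expectations carry no side condition on the function.\<close>

definition fin_supp :: "'a pmf list \<Rightarrow> bool" where
  "fin_supp ps \<longleftrightarrow> (\<forall>p\<in>set ps. finite (set_pmf p))"

lemma fin_supp_simps [simp]:
  "fin_supp []" "fin_supp (p # ps) \<longleftrightarrow> finite (set_pmf p) \<and> fin_supp ps"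
  "fin_supp (ps @ qs) \<longleftrightarrow> fin_supp ps \<and> fin_supp qs"
  "finite (set_pmf p) \<Longrightarrow> fin_supp (replicate k p)"
  by (auto simp: fin_supp_def)

lemma finite_list_pmf [simp]: "fin_supp ps \<Longrightarrow> finite (set_pmf (list_pmf ps))"
  by (induction ps) auto

lemma expect_list_pmf_Cons:
  assumes "fin_supp (p # ps)"
  shows "expect (list_pmf (p # ps)) f = expect p (\<lambda>x. expect (list_pmf ps) (\<lambda>xs. f (x # xs)))"
  using assms by (simp add: expect_bind)

lemma expect_list_pmf_append:
  assumes "fin_supp (ps @ qs)"
  shows "expect (list_pmf (ps @ qs)) f =
    expect (list_pmf ps) (\<lambda>xs. expect (list_pmf qs) (\<lambda>ys. f (xs @ ys)))"
  using assms
proof (induction ps arbitrary: f)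
  case (Cons p ps)
  then show ?case
    by (simp only: append_Cons expect_list_pmf_Cons) (simp add: expect_bind)
qed simp

lemma set_list_pmf:
  "xs \<in> set_pmf (list_pmf ps) \<Longrightarrow> list_all2 (\<lambda>x p. x \<in> set_pmf p) xs ps"
  by (induction ps arbitrary: xs) auto

lemma set_list_pmf_replicate:
  assumes "xs \<in> set_pmf (list_pmf (replicate k p))"
  shows "set xs \<subseteq> set_pmf p" "length xs = k"
  using set_list_pmf[OF assms] by (auto simp: list_all2_conv_all_nth in_set_conv_nth)

lemma expect_not_in_list:
  assumes "finite (set_pmf p)"
  shows "expect (list_pmf (replicate k p)) (\<lambda>xs. if t \<in> set xs then 0 else 1) = (1 - pmf p t) ^ k"
proof (induction k)
  case (Suc k)
  have *: "expect (list_pmf (replicate k p)) (\<lambda>xs. if t \<in> set (x # xs) then 0 else 1)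
      = (1 - indicator {t} x) * (1 - pmf p t) ^ k" for x
    using Suc by (cases "x = t") auto
  have "expect (list_pmf (replicate (Suc k) p)) (\<lambda>xs. if t \<in> set xs then 0 else 1)
      = expect p (\<lambda>x. (1 - indicator {t} x) * (1 - pmf p t) ^ k)"
    unfolding replicate_Suc using assms by (subst expect_list_pmf_Cons) (simp_all only: fin_supp_simps *)
  also have "\<dots> = (1 - pmf p t) ^ k * expect p (\<lambda>x. 1 - indicator {t} x)"
    by simp
  also have "expect p (\<lambda>x. 1 - indicator {t} x) = 1 - pmf p t"
    using assms by (subst expect_diff) (simp_all add: measure_pmf_single)
  finally show ?case by simp
qed simp

text \<open>The law of total variance, one coordinate at a time.\<close>

lemma variance_list_pmf:
  fixes f :: "'a list \<Rightarrow> real" and c :: real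
  assumes "fin_supp ps"
    and "\<And>xs x y ys. \<bar>f (xs @ x # ys) - f (xs @ y # ys)\<bar> \<le> c"
  shows "expect (list_pmf ps) (\<lambda>xs. (f xs - expect (list_pmf ps) f)\<^sup>2) \<le> length ps *
      c\<^sup>2"
  using assms
proof (induction ps arbitrary: f)
  case (Cons p ps)
  define g where "g x = expect (list_pmf ps) (\<lambda>xs. f (x # xs))" for x
  define m where "m = expect p g"
  have fp: "finite (set_pmf p)" and fps: "finite (set_pmf (list_pmf ps))" using Cons.prems by auto
  have m: "expect (list_pmf (p # ps)) f = m"
    using Cons.prems by (subst expect_list_pmf_Cons) (auto simp: m_def g_def[abs_def])
  \<comment> \<open>Given the first entry \<open>x\<close>, the second moment about \<open>m\<close>
    is the conditional variance plus the square of \<open>g x - m\<close>; the cross term vanishes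
    because \<open>g x\<close> is the conditional mean. Bounded differences pass from
    \<open>f\<close> to \<open>g\<close>, which bounds that square.\<close>
  have inner: "expect (list_pmf ps) (\<lambda>xs. (f (x # xs) - m)\<^sup>2) \<le> length ps * c\<^sup>2 +
      c\<^sup>2" for x
  proof -
    have "\<bar>g x - g y\<bar> \<le> c" for y
    proof -
      have "\<bar>g x - g y\<bar> = \<bar>expect (list_pmf ps) (\<lambda>xs. f (x # xs) - f (y # xs))\<bar>"
        unfolding g_def using fps by (simp add: expect_diff)
      also have "\<dots> \<le> expect (list_pmf ps) (\<lambda>xs. \<bar>f (x # xs) - f (y # xs)\<bar>)"
        by (rule integral_abs_bound)
      also have "\<dots> \<le> expect (list_pmf ps) (\<lambda>xs. c)"
        using Cons.prems(2)[of "[]"] by (intro expect_mono fps) auto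
      finally show ?thesis by simp
    qed
    then have "\<bar>expect p (\<lambda>y. g x - g y)\<bar> \<le> expect p (\<lambda>y. c)"
      by (intro order_trans[OF integral_abs_bound] expect_mono fp)
    then have gm: "(g x - m)\<^sup>2 \<le> c\<^sup>2"
      using fp by (simp add: expect_diff m_def abs_le_square_iff[symmetric])
    have "(\<lambda>xs. (f (x # xs) - m)\<^sup>2) =
        (\<lambda>xs. ((f (x # xs) - g x)\<^sup>2 + (2 * (g x - m)) * (f (x # xs) - g x)) + (g x -
            m)\<^sup>2)"
      by (auto simp: power2_eq_square algebra_simps)
    then have "expect (list_pmf ps) (\<lambda>xs. (f (x # xs) - m)\<^sup>2) =
        expect (list_pmf ps) (\<lambda>xs. (f (x # xs) - g x)\<^sup>2) + (g x - m)\<^sup>2"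
      using fps by (simp add: expect_add expect_diff g_def)
    also have "expect (list_pmf ps) (\<lambda>xs. (f (x # xs) - g x)\<^sup>2) \<le> length ps * c\<^sup>2"
      unfolding g_def
    proof (rule Cons.IH)
      show "\<bar>f (x # xs @ a # ys) - f (x # xs @ b # ys)\<bar> \<le> c" for xs a b ys
        using Cons.prems(2)[of "x # xs" a ys b] by simp
    qed (use Cons.prems in auto)
    finally show ?thesis using gm by linarith
  qed
  have "expect (list_pmf (p # ps)) (\<lambda>xs. (f xs - m)\<^sup>2)
      = expect p (\<lambda>x. expect (list_pmf ps) (\<lambda>xs. (f (x # xs) - m)\<^sup>2))"
    using Cons.prems by (subst expect_list_pmf_Cons) auto
  also have "\<dots> \<le> expect p (\<lambda>x. length ps * c\<^sup>2 + c\<^sup>2)"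
    using inner by (intro expect_mono fp)
  finally show ?case unfolding m by (simp add: algebra_simps)
qed simp

text \<open>Since |u| is at most u^2 / (2 \<sigma>) + \<sigma> / 2, any \<sigma> whose square
  dominates the variance bound also bounds the mean absolute deviation, without a square
  root.\<close>

lemma abs_deviation_list_pmf:
  fixes f :: "'a list \<Rightarrow> real" and c \<sigma> :: real
  assumes "fin_supp ps"
    and "\<And>xs x y ys. \<bar>f (xs @ x # ys) - f (xs @ y # ys)\<bar> \<le> c"
    and "length ps * c\<^sup>2 \<le> \<sigma>\<^sup>2" "\<sigma> > 0"
  shows "expect (list_pmf ps) (\<lambda>xs. \<bar>f xs - expect (list_pmf ps) f\<bar>) \<le> \<sigma>"
proof -
  let ?m = "expect (list_pmf ps) f"
  have fin: "finite (set_pmf (list_pmf ps))" using assms by simp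
  have amgm: "\<bar>u\<bar> \<le> inverse (2 * \<sigma>) * u\<^sup>2 + \<sigma> / 2" for u
  proof -
    have "0 \<le> (\<bar>u\<bar> - \<sigma>)\<^sup>2" by simp
    then have "2 * \<sigma> * \<bar>u\<bar> \<le> u\<^sup>2 + \<sigma>\<^sup>2" by (simp add: power2_diff
        algebra_simps)
    then show ?thesis using \<open>\<sigma> > 0\<close> by (simp add: field_simps power2_eq_square)
  qed
  have "expect (list_pmf ps) (\<lambda>xs. \<bar>f xs - ?m\<bar>)
      \<le> expect (list_pmf ps) (\<lambda>xs. inverse (2 * \<sigma>) * (f xs - ?m)\<^sup>2 + \<sigma> / 2)"
    by (intro expect_mono fin amgm)
  also have "\<dots> = inverse (2 * \<sigma>) * expect (list_pmf ps) (\<lambda>xs. (f xs - ?m)\<^sup>2) +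
      \<sigma> / 2"
    using fin by (simp add: expect_add)
  also have "\<dots> \<le> inverse (2 * \<sigma>) * \<sigma>\<^sup>2 + \<sigma> / 2"
    using order_trans[OF variance_list_pmf[OF assms(1), of f c] assms(3)] assms(2,4)
    by (intro add_right_mono mult_left_mono) auto
  also have "\<dots> = \<sigma>" using \<open>\<sigma> > 0\<close> by (simp add: power2_eq_square field_simps)
  finally show ?thesis .
qed

section \<open>Hall's theorem with deficiency\<close>

context
  fixes nb :: "'t \<Rightarrow> 'v set" and J :: "'v set"
begin

definition surplus :: "'t list \<Rightarrow> 'v set \<Rightarrow> int" where
  "surplus xs S = int (card S) - int (length (filter (\<lambda>t. nb t \<inter> S \<noteq> {}) xs))"

definition deficiency :: "'t list \<Rightarrow> int" where
  "deficiency xs = Max (surplus xs ` Pow J)"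

text \<open>The least maximiser of the surplus. That this intersection is itself a maximiser is
  \<open>surplus_core\<close>.\<close>

definition core :: "'t list \<Rightarrow> 'v set" where
  "core xs = J \<inter> \<Inter> {S. S \<subseteq> J \<and> surplus xs S = deficiency xs}"

definition matches :: "'t list \<Rightarrow> (nat \<times> 'v) set \<Rightarrow> bool" where
  "matches xs M \<longleftrightarrow> (\<forall>k j. (k, j) \<in> M \<longrightarrow> k < length xs
      \<and> j \<in> nb (xs ! k) \<and> j \<in> J) \<and>
     (\<forall>k j k' j'. (k, j) \<in> M \<longrightarrow> (k', j') \<in> M \<longrightarrow> (k = k'
         \<longleftrightarrow> j = j'))"

lemma surplus_Cons: "surplus (t # xs) S = surplus xs S - (if nb t \<inter> S = {} then 0 else 1)"
  by (auto simp: surplus_def)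

lemma surplus_append_commute: "surplus (xs @ ys) = surplus (ys @ xs)"
  by (rule ext) (simp add: surplus_def)

lemma deficiency_append_commute: "deficiency (xs @ ys) = deficiency (ys @ xs)"
  unfolding deficiency_def surplus_append_commute[of xs ys] ..

lemma deficiency_snoc: "deficiency (xs @ [t]) = deficiency (t # xs)"
  using deficiency_append_commute[of xs "[t]"] by simp

lemma deficiency_cong:
  assumes "\<And>S. S \<subseteq> J \<Longrightarrow> surplus xs S = surplus ys S"
  shows "deficiency xs = deficiency ys"
proof -
  have "surplus xs ` Pow J = surplus ys ` Pow J" using assms by (intro image_cong) auto
  then show ?thesis by (simp add: deficiency_def)
qed

lemma deficiency_move: "deficiency (xs @ t # ys) = deficiency (t # xs @ ys)"
  by (rule deficiency_cong) (simp add: surplus_def)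

context
  assumes J: "finite J"
begin

lemma surplus_le_deficiency: "S \<subseteq> J \<Longrightarrow> surplus xs S \<le> deficiency xs"
  using J by (auto simp: deficiency_def)

lemma deficiency_attained: obtains S where "S \<subseteq> J" "surplus xs S = deficiency xs"
proof -
  have "Max (surplus xs ` Pow J) \<in> surplus xs ` Pow J"
    using J by (intro Max_in) auto
  then show ?thesis using that by (auto simp: deficiency_def)
qed

lemma deficiency_leI: "(\<And>S. S \<subseteq> J \<Longrightarrow> surplus xs S \<le> b)
    \<Longrightarrow> deficiency xs \<le> b"
  by (metis deficiency_attained)

lemma deficiency_le_card: "deficiency xs \<le> int (card J)"
proof (rule deficiency_leI)
  fix S assume "S \<subseteq> J"
  then have "card S \<le> card J" by (rule card_mono[OF J])
  then show "surplus xs S \<le> int (card J)" by (simp add: surplus_def)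
qed

text \<open>Cardinality is modular, and each arrival subtracts a submodular term: whoever meets the
  intersection meets both sets, and whoever meets the union meets one of them.\<close>

lemma surplus_supermodular:
  assumes "S \<subseteq> J" "R \<subseteq> J"
  shows "surplus xs S + surplus xs R \<le> surplus xs (S \<union> R) + surplus xs (S \<inter> R)"
proof (induction xs)
  case Nil
  have "finite S" "finite R" using assms J finite_subset by auto
  then show ?case using card_Un_Int[of S R] by (simp add: surplus_def)
next
  case (Cons t xs)
  then show ?case by (auto simp: surplus_Cons)
qed

lemma core_subset: "core xs \<subseteq> J"
  by (auto simp: core_def)

text \<open>Supermodularity closes the family of maximisers under intersection, and the family is
  finite and nonempty.\<close>

lemma surplus_core: "surplus xs (core xs) = deficiency xs"
proof -
  define F where "F = {S. S \<subseteq> J \<and> surplus xs S = deficiency xs}"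
  have int_closed: "S \<inter> R \<in> F" if "S \<in> F" "R \<in> F" for S R
  proof -
    have sub: "S \<subseteq> J" "R \<subseteq> J" "S \<union> R \<subseteq> J" "S \<inter> R \<subseteq>
        J" using that by (auto simp: F_def)
    have "surplus xs S = deficiency xs" "surplus xs R = deficiency xs" using that by (auto simp: F_def)
    then have "surplus xs (S \<inter> R) \<ge> deficiency xs"
      using surplus_supermodular[OF sub(1,2), of xs] surplus_le_deficiency[OF sub(3), of xs] by linarith
    with surplus_le_deficiency[OF sub(4), of xs] sub(4) show ?thesis by (simp add: F_def)
  qed
  have "F \<subseteq> Pow J" by (auto simp: F_def)
  then have "finite F" using J finite_subset by blast
  have ne: "F \<noteq> {}"
  proof -
    obtain S where "S \<subseteq> J" "surplus xs S = deficiency xs" by (rule deficiency_attained)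
    then show ?thesis by (auto simp: F_def)
  qed
  have "\<Inter> G \<in> F" if "finite G" "G \<noteq> {}" "G \<subseteq> F" for G
    using that
  proof (induction G rule: finite_ne_induct)
    case (insert S G)
    then show ?case using int_closed[of S "\<Inter> G"] by simp
  qed simp
  then have mem: "\<Inter> F \<in> F" using \<open>finite F\<close> ne by blast
  then have "\<Inter> F \<subseteq> J" by (simp add: F_def)
  then have "core xs = \<Inter> F" unfolding core_def F_def[symmetric] by blast
  then show ?thesis using mem by (simp add: F_def)
qed

lemma core_least: "S \<subseteq> J \<Longrightarrow> surplus xs S = deficiency xs \<Longrightarrow> core
    xs \<subseteq> S"
  by (auto simp: core_def)

text \<open>An arrival that meets the core meets every maximiser, and all other sets were already at
  least one below the maximum by integrality. An arrival that misses the core leaves the surplus of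
  the core unchanged.\<close>

lemma deficiency_Cons:
  "deficiency (t # xs) = deficiency xs - (if nb t \<inter> core xs = {} then 0 else 1)"
proof (rule antisym)
  show "deficiency (t # xs) \<le> deficiency xs - (if nb t \<inter> core xs = {} then 0 else 1)"
  proof (rule deficiency_leI)
    fix S assume S: "S \<subseteq> J"
    show "surplus (t # xs) S \<le> deficiency xs - (if nb t \<inter> core xs = {} then 0 else 1)"
    proof (cases "surplus xs S = deficiency xs")
      case True
      then have "core xs \<subseteq> S" using S core_least by blast
      then show ?thesis using True by (auto simp: surplus_Cons)
    next
      case False
      then have "surplus xs S < deficiency xs" using surplus_le_deficiency[OF S, of xs] by simp
      then show ?thesis by (auto simp: surplus_Cons)
    qed
  qed
  show "deficiency xs - (if nb t \<inter> core xs = {} then 0 else 1) \<le> deficiency (t # xs)"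
    using surplus_le_deficiency[OF core_subset, of "t # xs" xs]
    by (simp add: surplus_Cons surplus_core)
qed

text \<open>The old core loses exactly as much surplus as the maximum does, so it remains a
  maximiser, though perhaps not the least one.\<close>

lemma core_Cons_subset: "core (t # xs) \<subseteq> core xs"
  by (rule core_least[OF core_subset]) (simp add: surplus_Cons surplus_core deficiency_Cons)

lemma core_append_subset: "core (ys @ xs) \<subseteq> core xs"
proof (induction ys)
  case (Cons y ys)
  then show ?case using core_Cons_subset[of y "ys @ xs"] by simp
qed simp

lemma deficiency_Cons_le: "deficiency (t # xs) \<le> deficiency xs" "deficiency xs \<le> deficiency (t #
    xs) + 1"
  by (auto simp: deficiency_Cons)

lemma deficiency_append_le: "deficiency (ys @ xs) \<le> deficiency xs"
proof (induction ys)
  case (Cons y ys)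
  then show ?case using deficiency_Cons_le(1)[of y "ys @ xs"] by simp
qed simp

lemma deficiency_append_ge: "deficiency xs \<le> deficiency (ys @ xs) + int (length ys)"
proof (induction ys)
  case (Cons y ys)
  then show ?case using deficiency_Cons_le(2)[of "ys @ xs" y] by simp
qed simp

lemma deficiency_change_one:
  "\<bar>deficiency (xs @ x # ys) - deficiency (xs @ y # ys)\<bar> \<le> 1"
  using deficiency_Cons_le(1)[of x "xs @ ys"] deficiency_Cons_le(1)[of y "xs @ ys"]
    deficiency_Cons_le(2)[of "xs @ ys" x] deficiency_Cons_le(2)[of "xs @ ys" y]
  by (simp add: deficiency_move[of xs x ys] deficiency_move[of xs y ys])

text \<open>Deleting \<open>v\<close> from a core that contains it costs one vertex but also saves
  the arrival \<open>t\<close>, whose only neighbour is \<open>v\<close>. A strictly smaller set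
  would then be a maximiser.\<close>

lemma notin_core_if_loop:
  assumes "t \<in> set xs" "nb t = {v}"
  shows "v \<notin> core xs"
proof
  assume v: "v \<in> core xs"
  obtain A B where AB: "xs = A @ t # B" using assms(1) by (auto simp: in_set_conv_decomp)
  let ?ys = "A @ B" and ?S = "core xs - {v}"
  have "length (filter (\<lambda>t. nb t \<inter> ?S \<noteq> {}) zs) \<le> length (filter (\<lambda>t.
      nb t \<inter> core xs \<noteq> {}) zs)" for zs
    by (induction zs) auto
  from this[of A] this[of B]
  have le: "length (filter (\<lambda>t. nb t \<inter> ?S \<noteq> {}) ?ys) \<le> length (filter
      (\<lambda>t. nb t \<inter> core xs \<noteq> {}) ?ys)"
    by simp
  have "finite (core xs)" using J core_subset finite_subset by blast
  then have card: "card (core xs) = Suc (card ?S)" using v by (rule card.remove)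
  have "surplus xs ?S \<ge> surplus xs (core xs)"
    using le card v assms(2) by (simp add: surplus_def AB)
  moreover have "?S \<subseteq> J" using core_subset by blast
  ultimately have "core xs \<subseteq> ?S"
    using surplus_le_deficiency[of ?S xs] surplus_core[of xs] by (intro core_least) auto
  then show False using v by blast
qed

lemma matches_finite: "matches xs M \<Longrightarrow> finite M"
  by (rule finite_subset[of _ "{..<length xs} \<times> J"]) (auto simp: matches_def J)

lemma matches_weaken: "matches xs M \<Longrightarrow> matches (xs @ [t]) M"
  by (auto simp: matches_def nth_append intro: less_SucI)

lemma matches_insert:
  assumes M: "matches xs M" and "v \<in> nb t" "v \<in> J" "v \<notin> snd ` M"
  shows "matches (xs @ [t]) (insert (length xs, v) M)"
proof -
  have "k < length xs" "j \<in> nb (xs ! k)" "j \<in> J" "j \<noteq> v" if "(k, j) \<in> M" for k j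
    using M that assms(4) by (auto simp: matches_def image_iff)
  moreover have "k = k' \<longleftrightarrow> j = j'" if "(k, j) \<in> M" "(k', j') \<in> M" for k j k' j'
    using M that unfolding matches_def by blast
  ultimately show ?thesis
    using assms(2,3) unfolding matches_def by (simp add: nth_append) (metis less_irrefl less_SucI)
qed

text \<open>The deficiency form of Hall's theorem.  The induction over the arrivals goes through because the
  statement also asks for a maximum matching that avoids the vertices of \<^term>\<open>L\<close>,
      whenever adding one
  further arrival at each of these vertices would lower the deficiency every time.\<close>

lemma matching_avoiding:
  fixes loop :: "'v \<Rightarrow> 't"
  assumes loop: "\<And>v. v \<in> J \<Longrightarrow> nb (loop v) = {v}" and "set L \<subseteq> J"
    and "deficiency (map loop L @ xs) = deficiency xs - int (length L)"
  shows "\<exists>M. matches xs M \<and> int (card M) = int (card J) - deficiency xs \<and> snd ` M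
      \<inter> set L = {}"
  using assms(2,3)
proof (induction xs arbitrary: L rule: rev_induct)
  case Nil
  have "surplus [] J \<le> deficiency []" by (intro surplus_le_deficiency) simp
  then have "deficiency [] = int (card J)"
    using deficiency_le_card[of "[]"] by (simp add: surplus_def)
  then show ?case by (intro exI[of _ "{}"]) (simp add: matches_def)
next
  case (snoc t xs)
  let ?L = "map loop L"
  have eq: "deficiency (t # ?L @ xs) = deficiency (t # xs) - int (length L)"
    using snoc.prems(2) deficiency_snoc[of "?L @ xs" t] deficiency_snoc[of xs t] by simp
  have low: "deficiency xs \<le> deficiency (?L @ xs) + int (length L)"
    using deficiency_append_ge[of xs ?L] by simp
  have sub: "core (?L @ xs) \<subseteq> core xs" by (rule core_append_subset)
  \<comment> \<open>The arrivals at \<open>L\<close> lower the deficiency every time even before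
    \<open>t\<close> is counted: cores only shrink, so a \<open>t\<close> that meets the core after
    them also meets it before them.\<close>
  have same: "deficiency (?L @ xs) = deficiency xs - int (length L)"
  proof (cases "nb t \<inter> core (?L @ xs) = {}")
    case True
    then show ?thesis using eq low by (simp add: deficiency_Cons split: if_splits)
  next
    case False
    then have "nb t \<inter> core xs \<noteq> {}" using sub by blast
    then show ?thesis using eq False by (simp add: deficiency_Cons)
  qed
  show ?case
  proof (cases "nb t \<inter> core xs = {}")
    case True
    obtain M where M: "matches xs M" "int (card M) = int (card J) - deficiency xs" "snd ` M \<inter> set
        L = {}"
      using snoc.IH[OF snoc.prems(1) same] by blast
    have "int (card M) = int (card J) - deficiency (xs @ [t])"
      using M(2) True by (simp add: deficiency_snoc deficiency_Cons)
    then show ?thesis using matches_weaken[OF M(1)] M(3) by blast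
  next
    case False
    have "nb t \<inter> core (?L @ xs) \<noteq> {}"
    proof
      assume "nb t \<inter> core (?L @ xs) = {}"
      then show False using eq same False by (simp add: deficiency_Cons)
    qed
    \<comment> \<open>\<open>t\<close> will be matched to \<open>v\<close>. As \<open>v\<close>
      survives in the core after the arrivals at \<open>L\<close>, one more arrival at
      \<open>v\<close> lowers the deficiency again, so the induction hypothesis for
      \<open>v # L\<close> yields a matching that leaves \<open>v\<close> free.\<close>
    then obtain v where v: "v \<in> nb t" "v \<in> core (?L @ xs)" by blast
    then have vJ: "v \<in> J" using core_subset by blast
    have def_v: "deficiency (map loop (v # L) @ xs) = deficiency xs - int (length (v # L))"
      using v(2) same by (simp add: deficiency_Cons loop[OF vJ])
    have "set (v # L) \<subseteq> J" using vJ snoc.prems(1) by simp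
    from snoc.IH[OF this def_v] obtain M where M: "matches xs M"
      "int (card M) = int (card J) - deficiency xs" "snd ` M \<inter> set (v # L) = {}"
      by blast
    have vM: "v \<notin> snd ` M" and disj: "snd ` M \<inter> set L = {}" using M(3) by auto
    have "(length xs, v) \<notin> M" using vM by force
    then have "int (card (insert (length xs, v) M)) = int (card J) - deficiency (xs @ [t])"
      using matches_finite[OF M(1)] M(2) False by (simp add: deficiency_snoc deficiency_Cons)
    moreover have "v \<notin> set L"
    proof
      assume "v \<in> set L"
      then have "loop v \<in> set (?L @ xs)" by simp
      then show False using v(2) notin_core_if_loop loop[OF vJ] by metis
    qed
    then have "snd ` insert (length xs, v) M \<inter> set L = {}" using disj by simp
    ultimately show ?thesis using matches_insert[OF M(1) v(1) vJ vM] by blast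
  qed
qed

lemma hall_deficiency:
  fixes loop :: "'v \<Rightarrow> 't"
  assumes "\<And>v. v \<in> J \<Longrightarrow> nb (loop v) = {v}"
  obtains M where "matches xs M" "int (card M) = int (card J) - deficiency xs"
  using matching_avoiding[OF assms, of "[]" xs] by auto

end

end

section \<open>The instance\<close>

datatype ty = High nat | Priv nat | Trip nat nat nat | Glob | Dummy

instance ty :: countable
  by countable_datatype

abbreviation highW :: real where "highW \<equiv> 100000"

fun wt :: "ty \<Rightarrow> real" where
  "wt (High j) = highW"
| "wt (Priv j) = 6 / 5"
| "wt (Trip a b c) = 1"
| "wt Glob = 1"
| "wt Dummy = 0"

fun nbr :: "nat \<Rightarrow> ty \<Rightarrow> nat set" where
  "nbr n (High j) = {j}"
| "nbr n (Priv j) = {j}"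
| "nbr n (Trip a b c) = {a, b, c}"
| "nbr n Glob = {..<n}"
| "nbr n Dummy = {}"

text \<open>Rare and global arrivals are left out. Dropping the rare ones can only raise the
  deficiency; the global ones are subtracted in \<open>deficiency_full_le\<close>.\<close>

fun nbr_pt :: "ty \<Rightarrow> nat set" where
  "nbr_pt (Priv j) = {j}"
| "nbr_pt (Trip a b c) = {a, b, c}"
| "nbr_pt _ = {}"

text \<open>Each probability is half the expected number per offline vertex, because there are
  \<open>2 * n\<close> arrivals; the last class is a dummy that fills up the total.\<close>

definition class_pmf :: "nat pmf" where
  "class_pmf = pmf_of_list [(0, 1 / 200000), (1, 1 / 8), (2, 3 / 10), (3, 99 / 1000), (4, 95199 / 200000)]"

definition unif :: "nat \<Rightarrow> nat pmf" where
  "unif n = pmf_of_set {..<n}"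

text \<open>The ends of a triple are drawn with repetition, so the probability of missing a set of
  \<open>y * n\<close> vertices is exactly (1 - y)^3.\<close>

definition arr :: "nat \<Rightarrow> ty pmf" where
  "arr n = bind_pmf class_pmf (\<lambda>k.
     if k = 0 then map_pmf High (unif n)
     else if k = 1 then map_pmf Priv (unif n)
     else if k = 2 then bind_pmf (unif n) (\<lambda>a. bind_pmf (unif n) (\<lambda>b. map_pmf (Trip a b)
         (unif n)))
     else if k = 3 then return_pmf Glob
     else return_pmf Dummy)"

lemma class_pmf_wf:
  "pmf_of_list_wf [(0::nat, 1 / 200000 :: real), (1, 1 / 8), (2, 3 / 10), (3, 99 / 1000), (4, 95199 /
      200000)]"
  by (rule pmf_of_list_wfI) auto

lemma expect_class_pmf:
  "expect class_pmf f = f 0 / 200000 + f 1 / 8 + 3 / 10 * f 2 + 99 / 1000 * f 3 + 95199 / 200000 * f 4"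
proof -
  have "set_pmf class_pmf \<subseteq> {0, 1, 2, 3, 4}"
    using set_pmf_of_list[OF class_pmf_wf] by (simp add: class_pmf_def)
  then have "expect class_pmf f = (\<Sum>k\<in>{0, 1, 2, 3, 4}. pmf class_pmf k * f k)"
    using integral_measure_pmf[of "{0, 1, 2, 3, 4}" class_pmf f] by auto
  moreover note pmf_pmf_of_list[OF class_pmf_wf, folded class_pmf_def]
  ultimately show ?thesis by simp
qed

lemma finite_class_pmf [simp]: "finite (set_pmf class_pmf)"
  unfolding class_pmf_def using finite_set_pmf_of_list[OF class_pmf_wf] .

context
  fixes n :: nat
  assumes n: "n > 0"
begin

lemma set_unif [simp]: "set_pmf (unif n) = {..<n}"
  using n by (simp add: unif_def lessThan_empty_iff)

lemma expect_unif: "expect (unif n) f = (\<Sum>j<n. f j) / n"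
  using n by (simp add: unif_def integral_pmf_of_set lessThan_empty_iff)

lemma finite_arr [simp]: "finite (set_pmf (arr n))"
  by (auto simp: arr_def)

lemma expect_arr:
  "expect (arr n) f = expect (unif n) (\<lambda>j. f (High j)) / 200000 + expect (unif n) (\<lambda>j. f
      (Priv j)) / 8
     + 3 / 10 * expect (unif n) (\<lambda>a. expect (unif n) (\<lambda>b. expect (unif n) (\<lambda>c. f
         (Trip a b c))))
     + 99 / 1000 * f Glob + 95199 / 200000 * f Dummy"
  unfolding arr_def by (subst expect_bind) (auto simp: expect_class_pmf expect_bind)

lemma set_arr: "t \<in> set_pmf (arr n) \<Longrightarrow> nbr n t \<subseteq> {..<n}"
  by (auto simp: arr_def split: if_splits)

lemma expect_unif_mem:
  assumes "S \<subseteq> {..<n}"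
  shows "expect (unif n) (\<lambda>j. if j \<in> S then a else b) = b + (a - b) * (card S / n)"
proof -
  have "(\<Sum>j<n. if j \<in> S then a else b) = (\<Sum>j\<in>S. a) + (\<Sum>j\<in>{..<n} - S. b)"
    using assms by (subst sum.If_cases) (auto simp: Int_absorb1 Diff_eq)
  also have "\<dots> = card S * a + (real n - card S) * b"
    using assms by (simp add: card_Diff_subset finite_subset of_nat_diff[OF card_mono, of "{..<n}",
        simplified])
  finally show ?thesis
    using n by (simp add: expect_unif field_simps)
qed

lemma expect_unif_notin:
  assumes "S \<subseteq> {..<n}"
  shows "expect (unif n) (\<lambda>j. if j \<notin> S then 0 else a) = a * (card S / n)"
proof -
  have "(\<lambda>j. if j \<notin> S then 0 else a) = (\<lambda>j. if j \<in> S then a else 0)" by auto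
  then show ?thesis using expect_unif_mem[OF assms, of a 0] by simp
qed

lemma expect_trip_meets:
  assumes "S \<subseteq> {..<n}"
  shows "expect (unif n) (\<lambda>a. expect (unif n) (\<lambda>b. expect (unif n) (\<lambda>c.
      if {a, b, c} \<inter> S = {} then 0 else 1))) = 1 - (1 - card S / n) ^ 3"
proof -
  define y where "y = card S / n"
  note mem = expect_unif_mem[OF assms, folded y_def]
  have c: "expect (unif n) (\<lambda>c. if {a, b, c} \<inter> S = {} then 0 else 1)
      = (if b \<in> S then 1 else if a \<in> S then 1 else y)" for a b
    using expect_unif_notin[OF assms, of 1] by (cases "a \<in> S"; cases "b \<in> S") (simp_all add: y_def)
  have b: "expect (unif n) (\<lambda>b. if b \<in> S then 1 else if a \<in> S then 1 else y)
      = (if a \<in> S then 1 else y + (1 - y) * y)" for a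
    by (subst mem) simp
  show ?thesis
    unfolding c b y_def[symmetric] by (subst mem) (simp add: power3_eq_cube algebra_simps)
qed

text \<open>With \<open>G\<close> the positive part of weight minus price and \<open>S\<close> the
  set of free vertices, this is the expected profit of one arrival.\<close>

lemma expect_arr_meets:
  assumes "S \<subseteq> {..<n}"
  shows "expect (arr n) (\<lambda>t. if nbr n t \<inter> S = {} then 0 else G (wt t)) =
     card S / n * (G highW / 200000 + G (6 / 5) / 8)
     + G 1 * (3 / 10 * (1 - (1 - card S / n) ^ 3) + (if S = {} then 0 else 99 / 1000))"
proof -
  have 1: "expect (unif n) (\<lambda>j. if nbr n (High j) \<inter> S = {} then 0 else G (wt (High j)))
      = card S / n * G highW"
    using expect_unif_notin[OF assms, of "G highW"] unfolding nbr.simps wt.simps by simp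
  have 2: "expect (unif n) (\<lambda>j. if nbr n (Priv j) \<inter> S = {} then 0 else G (wt (Priv j)))
      = card S / n * G (6 / 5)"
    using expect_unif_notin[OF assms, of "G (6 / 5)"] unfolding nbr.simps wt.simps by simp
  have eq: "(if nbr n (Trip a b c) \<inter> S = {} then 0 else G (wt (Trip a b c)))
      = G 1 * (if {a, b, c} \<inter> S = {} then 0 else 1)" for a b c
    by simp
  have 3: "expect (unif n) (\<lambda>a. expect (unif n) (\<lambda>b. expect (unif n) (\<lambda>c.
      if nbr n (Trip a b c) \<inter> S = {} then 0 else G (wt (Trip a b c)))))
      = G 1 * (1 - (1 - card S / n) ^ 3)"
    unfolding eq expect_cmult expect_trip_meets[OF assms] ..
  have "{..<n} \<inter> S = S" using assms by blast
  then show ?thesis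
    unfolding expect_arr 1 2 3 by (auto simp: algebra_simps)
qed

lemma expect_arr_meets_pt:
  assumes "S \<subseteq> {..<n}"
  shows "expect (arr n) (\<lambda>t. if nbr_pt t \<inter> S = {} then 0 else 1) =
     card S / n / 8 + 3 / 10 * (1 - (1 - card S / n) ^ 3)"
proof -
  have 2: "expect (unif n) (\<lambda>j. if nbr_pt (Priv j) \<inter> S = {} then 0 else 1) = card S / n"
    using expect_unif_notin[OF assms, of 1] by simp
  have 3: "expect (unif n) (\<lambda>a. expect (unif n) (\<lambda>b. expect (unif n) (\<lambda>c.
      if nbr_pt (Trip a b c) \<inter> S = {} then 0 else 1))) = 1 - (1 - card S / n) ^ 3"
    unfolding nbr_pt.simps expect_trip_meets[OF assms] ..
  show ?thesis
    unfolding expect_arr 2 3 by simp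
qed

lemma pmf_unif: "j < n \<Longrightarrow> pmf (unif n) j = 1 / n"
  using n by (simp add: unif_def lessThan_empty_iff)

lemma pmf_arr_Priv:
  assumes "j < n"
  shows "pmf (arr n) (Priv j) = 1 / (8 * n)"
proof -
  have "pmf (arr n) (Priv j) = expect (arr n) (indicator {Priv j})"
    by (simp add: measure_pmf_single)
  also have "\<dots> = 1 / (8 * n)"
    unfolding expect_arr using expect_unif_mem[of "{j}" 1 0] assms
    by (simp add: indicator_def of_bool_def)
  finally show ?thesis .
qed

lemma pmf_arr_High:
  assumes "j < n"
  shows "pmf (arr n) (High j) = 1 / (200000 * n)"
proof -
  have "pmf (arr n) (High j) = expect (arr n) (indicator {High j})"
    by (simp add: measure_pmf_single)
  also have "\<dots> = 1 / (200000 * n)"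
    unfolding expect_arr using expect_unif_mem[of "{j}" 1 0] assms
    by (simp add: indicator_def of_bool_def)
  finally show ?thesis .
qed

end

section \<open>The mean deficiency\<close>

definition unsat :: "nat \<Rightarrow> ty list \<Rightarrow> real" where
  "unsat n xs = real_of_int (deficiency nbr_pt {..<n} xs)"

definition core_frac :: "nat \<Rightarrow> ty list \<Rightarrow> real" where
  "core_frac n xs = card (core nbr_pt {..<n} xs) / n"

definition loop_pmf :: "nat \<Rightarrow> ty pmf" where
  "loop_pmf n = map_pmf Priv (unif n)"

definition unsat_after :: "nat \<Rightarrow> nat \<Rightarrow> ty list \<Rightarrow> real" where
  "unsat_after n K xs = expect (list_pmf (replicate K (loop_pmf n))) (\<lambda>L. unsat n (L @ xs))"

text \<open>The number \<open>l\<close> of extra private arrivals is a space variable and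
  \<open>k\<close> is time. The one-step difference in \<open>l\<close> is the mean core fraction,
  and the core fraction governs the decrease in \<open>k\<close>.\<close>

definition mean_unsat :: "nat \<Rightarrow> nat \<Rightarrow> nat \<Rightarrow> real" where
  "mean_unsat n l k = expect (list_pmf (replicate l (loop_pmf n) @ replicate k (arr n))) (unsat n)"

lemma cube_lipschitz:
  fixes a b d :: real
  assumes "0 \<le> a" "a \<le> 1" "0 \<le> b" "b \<le> 1" "0 \<le> d" "a \<le> b + d"
  shows "a ^ 3 \<le> b ^ 3 + 3 * d"
proof (cases "a \<le> b")
  case True
  then have "a ^ 3 \<le> b ^ 3" using assms by (intro power_mono) auto
  then show ?thesis using assms(5) by linarith
next
  case False
  have "a * a \<le> 1" "a * b \<le> 1" "b * b \<le> 1" using assms by (auto intro: mult_le_one)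
  then have "(a - b) * (a * a + a * b + b * b) \<le> (a - b) * 3"
    using False by (intro mult_left_mono) auto
  then have "a ^ 3 - b ^ 3 \<le> (a - b) * 3" by (simp add: power3_eq_cube algebra_simps)
  also have "\<dots> \<le> d * 3" using assms(6) by simp
  finally show ?thesis by (simp add: algebra_simps)
qed

context
  fixes n :: nat
  assumes n: "n > 0"
begin

lemma finite_loop_pmf [simp]: "finite (set_pmf (loop_pmf n))"
  using set_unif[OF n] by (simp add: loop_pmf_def)

lemmas [simp] = finite_arr[OF n]

lemma core_frac_bounds: "0 \<le> core_frac n xs" "core_frac n xs \<le> 1"
proof -
  have "card (core nbr_pt {..<n} xs) \<le> card {..<n}"
    by (intro card_mono core_subset) auto
  then show "core_frac n xs \<le> 1" using n by (simp add: core_frac_def)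
qed (simp add: core_frac_def)

lemma core_frac_append: "core_frac n (L @ xs) \<le> core_frac n xs"
proof -
  have "finite (core nbr_pt {..<n} xs)"
    using core_subset[of "{..<n}" nbr_pt xs] finite_subset by blast
  then have "card (core nbr_pt {..<n} (L @ xs)) \<le> card (core nbr_pt {..<n} xs)"
    using core_append_subset[of "{..<n}" nbr_pt L xs] by (intro card_mono) auto
  then show ?thesis by (simp add: core_frac_def divide_right_mono)
qed

lemma unsat_Cons: "unsat n (t # xs) = unsat n xs - (if nbr_pt t \<inter> core nbr_pt {..<n} xs = {} then
    0 else 1)"
  by (simp add: unsat_def deficiency_Cons)

lemma unsat_snoc: "unsat n (xs @ [t]) = unsat n (t # xs)"
  by (simp add: unsat_def deficiency_snoc)

lemma unsat_append_le: "unsat n (L @ xs) \<le> unsat n xs"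
  using deficiency_append_le[of "{..<n}" nbr_pt L xs] by (simp add: unsat_def)

lemma unsat_change_one: "\<bar>unsat n (xs @ x # ys) - unsat n (xs @ y # ys)\<bar> \<le> 1"
proof -
  have "\<bar>real_of_int (deficiency nbr_pt {..<n} (xs @ x # ys) - deficiency nbr_pt {..<n} (xs @ y #
      ys))\<bar> \<le> 1"
    using deficiency_change_one[OF finite_lessThan[of n], of nbr_pt xs x ys y] by linarith
  then show ?thesis by (simp add: unsat_def)
qed

lemma core_sub: "core nbr_pt {..<n} xs \<subseteq> {..<n}"
  by (rule core_subset) simp

lemma expect_loop_unsat: "expect (loop_pmf n) (\<lambda>t. unsat n (t # xs)) = unsat n xs - core_frac n xs"
proof -
  have "expect (loop_pmf n) (\<lambda>t. unsat n (t # xs)) =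
      expect (unif n) (\<lambda>j. unsat n xs - (if j \<notin> core nbr_pt {..<n} xs then 0 else 1))"
    by (simp add: loop_pmf_def unsat_Cons)
  also have "\<dots> = unsat n xs - core_frac n xs"
    using expect_unif_notin[OF n core_sub[of xs], where a = 1] set_unif[OF n]
    by (subst expect_diff) (simp_all add: core_frac_def)
  finally show ?thesis .
qed

lemma expect_arr_unsat:
  "expect (arr n) (\<lambda>t. unsat n (xs @ [t])) =
     unsat n xs - (core_frac n xs / 8 + 3 / 10 * (1 - (1 - core_frac n xs) ^ 3))"
  unfolding unsat_snoc unsat_Cons using expect_arr_meets_pt[OF n core_sub[of xs]]
  by (subst expect_diff) (simp_all add: core_frac_def)

text \<open>Further private arrivals only shrink the core, so each of them lowers the mean by at
  most the initial core fraction.\<close>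

lemma unsat_after_ge: "unsat n xs - K * core_frac n xs \<le> unsat_after n K xs"
proof (induction K)
  case (Suc K)
  let ?P = "list_pmf (replicate K (loop_pmf n))"
  have fin: "finite (set_pmf ?P)" by simp
  have "unsat_after n (Suc K) xs = expect (loop_pmf n) (\<lambda>t. expect ?P (\<lambda>L. unsat n (t # L
      @ xs)))"
    unfolding unsat_after_def replicate_Suc by (subst expect_list_pmf_Cons) simp_all
  also have "\<dots> = expect ?P (\<lambda>L. expect (loop_pmf n) (\<lambda>t. unsat n (t # L @ xs)))"
    by (rule expect_swap) simp_all
  also have "\<dots> = expect ?P (\<lambda>L. unsat n (L @ xs) - core_frac n (L @ xs))"
    by (simp only: expect_loop_unsat)
  also have "\<dots> \<ge> expect ?P (\<lambda>L. unsat n (L @ xs) - core_frac n xs)"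
    using core_frac_append by (intro expect_mono fin) auto
  also have "expect ?P (\<lambda>L. unsat n (L @ xs) - core_frac n xs) = unsat_after n K xs - core_frac n xs"
    using fin by (simp add: expect_diff unsat_after_def)
  finally show ?case using Suc by (simp add: algebra_simps)
qed (simp add: unsat_after_def)

lemma unsat_after_le: "unsat_after n K xs \<le> unsat n xs"
proof -
  have "unsat_after n K xs \<le> expect (list_pmf (replicate K (loop_pmf n))) (\<lambda>_. unsat n xs)"
    unfolding unsat_after_def by (intro expect_mono unsat_append_le) simp
  then show ?thesis by simp
qed

lemma unsat_after_change_one:
  "\<bar>unsat_after n K (xs @ x # ys) - unsat_after n K (xs @ y # ys)\<bar> \<le> 1"
proof -
  let ?P = "list_pmf (replicate K (loop_pmf n))"
  have fin: "finite (set_pmf ?P)" by simp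
  have "\<bar>unsat_after n K (xs @ x # ys) - unsat_after n K (xs @ y # ys)\<bar>
      = \<bar>expect ?P (\<lambda>L. unsat n (L @ xs @ x # ys) - unsat n (L @ xs @ y # ys))\<bar>"
    using fin by (simp add: unsat_after_def expect_diff)
  also have "\<dots> \<le> expect ?P (\<lambda>L. \<bar>unsat n (L @ xs @ x # ys) - unsat n (L @ xs @ y #
      ys)\<bar>)"
    by (rule integral_abs_bound)
  also have "\<dots> \<le> expect ?P (\<lambda>_. 1)"
    using unsat_change_one[of "_ @ xs"] by (intro expect_mono fin) simp
  finally show ?thesis by simp
qed

lemma mean_unsat_add_loops:
  "mean_unsat n (l + K) k = expect (list_pmf (replicate l (loop_pmf n) @ replicate k (arr n)))
      (unsat_after n K)"
proof -
  let ?ps = "replicate l (loop_pmf n) @ replicate k (arr n)"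
  have eq: "replicate (l + K) (loop_pmf n) @ replicate k (arr n) = replicate K (loop_pmf n) @ ?ps"
    by (simp add: add.commute replicate_add)
  have "mean_unsat n (l + K) k = expect (list_pmf (replicate K (loop_pmf n)))
      (\<lambda>L. expect (list_pmf ?ps) (\<lambda>xs. unsat n (L @ xs)))"
    unfolding mean_unsat_def eq by (rule expect_list_pmf_append) simp
  also have "\<dots> = expect (list_pmf ?ps) (unsat_after n K)"
    unfolding unsat_after_def[abs_def] by (rule expect_swap) simp_all
  finally show ?thesis .
qed

lemma mean_unsat_Suc:
  "mean_unsat n l (Suc k) = mean_unsat n l k
     - expect (list_pmf (replicate l (loop_pmf n) @ replicate k (arr n)))
         (\<lambda>xs. core_frac n xs / 8 + 3 / 10 * (1 - (1 - core_frac n xs) ^ 3))"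
proof -
  let ?ps = "replicate l (loop_pmf n) @ replicate k (arr n)"
  have eq: "replicate l (loop_pmf n) @ replicate (Suc k) (arr n) = ?ps @ [arr n]"
    by (simp add: replicate_append_same)
  have "mean_unsat n l (Suc k) = expect (list_pmf ?ps) (\<lambda>xs. expect (list_pmf [arr n])
      (\<lambda>ys. unsat n (xs @ ys)))"
    unfolding mean_unsat_def eq by (rule expect_list_pmf_append) simp
  also have "\<dots> = expect (list_pmf ?ps) (\<lambda>xs. expect (arr n) (\<lambda>t. unsat n (xs @ [t])))"
    by (subst expect_list_pmf_Cons) simp_all
  finally show ?thesis
    unfolding expect_arr_unsat mean_unsat_def by (subst (asm) expect_diff) simp_all
qed

lemma mean_unsat_mono: "mean_unsat n l (Suc k) \<le> mean_unsat n l k"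
proof -
  have "0 \<le> expect (list_pmf (replicate l (loop_pmf n) @ replicate k (arr n)))
         (\<lambda>xs. core_frac n xs / 8 + 3 / 10 * (1 - (1 - core_frac n xs) ^ 3))"
  proof (rule Bochner_Integration.integral_nonneg)
    fix xs
    have "(1 - core_frac n xs) ^ 3 \<le> 1" using core_frac_bounds[of xs] by (intro power_le_one) auto
    then show "0 \<le> core_frac n xs / 8 + 3 / 10 * (1 - (1 - core_frac n xs) ^ 3)"
      using core_frac_bounds[of xs] by simp
  qed
  then show ?thesis by (simp add: mean_unsat_Suc)
qed

lemma mean_unsat_le_0: "mean_unsat n l k \<le> mean_unsat n l 0"
proof (induction k)
  case (Suc k)
  then show ?case using mean_unsat_mono[of l k] by simp
qed simp

text \<open>The deficiency is at most the number of vertices without a private arrival, and each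
  vertex is missed with probability (1 - 1/n)^l.\<close>

lemma mean_unsat_0: "mean_unsat n l 0 \<le> n * (1 - 1 / n) ^ l"
proof -
  let ?P = "list_pmf (replicate l (loop_pmf n))"
  have fin: "finite (set_pmf ?P)" by simp
  have le: "unsat n xs \<le> (\<Sum>j<n. if Priv j \<in> set xs then 0 else 1)" for xs
  proof -
    let ?H = "{j\<in>{..<n}. Priv j \<in> set xs}"
    have "deficiency nbr_pt {..<n} xs \<le> int (card ({..<n} - ?H))"
    proof (rule deficiency_leI)
      fix S assume S: "S \<subseteq> {..<n}"
      then have "finite S" using finite_subset by blast
      \<comment> \<open>Distinct hit vertices of \<open>S\<close> have distinct private arrivals,
        all of which meet \<open>S\<close>.\<close>
      have "card (S \<inter> ?H) = card (Priv ` (S \<inter> ?H))"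
        by (rule card_image[symmetric]) (auto simp: inj_on_def)
      also have "\<dots> \<le> card (set (filter (\<lambda>t. nbr_pt t \<inter> S \<noteq> {}) xs))"
        by (intro card_mono) auto
      also have "\<dots> \<le> length (filter (\<lambda>t. nbr_pt t \<inter> S \<noteq> {}) xs)" by (rule
          card_length)
      finally have 1: "card (S \<inter> ?H) \<le> length (filter (\<lambda>t. nbr_pt t \<inter> S
          \<noteq> {}) xs)" .
      have "card S = card (S \<inter> ?H) + card (S - ?H)"
        using \<open>finite S\<close> by (metis card_Int_Diff)
      moreover have "card (S - ?H) \<le> card ({..<n} - ?H)" using S by (intro card_mono) auto
      ultimately show "surplus nbr_pt xs S \<le> int (card ({..<n} - ?H))"
        using 1 by (simp add: surplus_def)
    qed simp
    moreover have "(\<Sum>j<n. if Priv j \<in> set xs then 0 else 1) = real (card ({..<n} - ?H))"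
    proof -
      have "(\<Sum>j<n. if Priv j \<in> set xs then 0 else 1) = (\<Sum>j\<in>{..<n} - ?H. 1 :: real)"
        by (intro sum.mono_neutral_cong_right) auto
      then show ?thesis by simp
    qed
    ultimately show ?thesis unfolding unsat_def by linarith
  qed
  have pm: "pmf (loop_pmf n) (Priv j) = 1 / n" if "j < n" for j
    using pmf_unif[OF n that] pmf_map_inj'[of Priv "unif n" j] by (simp add: loop_pmf_def inj_on_def)
  have "mean_unsat n l 0 \<le> expect ?P (\<lambda>xs. \<Sum>j<n. if Priv j \<in> set xs then 0 else 1)"
    unfolding mean_unsat_def replicate_0 append_Nil2 by (rule expect_mono[OF fin le])
  also have "\<dots> = (\<Sum>j<n. expect ?P (\<lambda>xs. if Priv j \<in> set xs then 0 else 1))"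
    by (rule expect_sum[OF fin])
  also have "\<dots> = (\<Sum>j<n. (1 - 1 / n) ^ l)"
    by (intro sum.cong refl) (simp add: expect_not_in_list pm)
  finally show ?thesis by simp
qed

end

text \<open>Here \<^term>\<open>m\<close> is the average slope of the mean deficiency over the next
    \<open>N\<^sup>3\<close> private arrivals.
  By concavity the core fraction dominates the realised slope, and the latter concentrates around
  \<^term>\<open>m\<close>.\<close>

lemma mean_unsat_step:
  fixes N l k :: nat
  defines "n \<equiv> N ^ 4"
  defines "m \<equiv> (mean_unsat n l k - mean_unsat n (l + N ^ 3) k) / N ^ 3"
  assumes N: "N > 0" and l: "l \<le> 16 * n" and k: "k \<le> 2 * n"
    and y: "0 \<le> y" "y \<le> 1" and m: "m \<ge> y - 12 / N"
  shows "mean_unsat n l (Suc k) \<le> mean_unsat n l k - (y / 8 + 3 / 10 * (1 - (1 - y) ^ 3)) + 23 / N"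
proof -
  have n: "n > 0" using N by (simp add: n_def)
  note [simp] = finite_loop_pmf[OF n] finite_arr[OF n]
  let ?K = "N ^ 3"
  let ?ps = "replicate l (loop_pmf n) @ replicate k (arr n)"
  let ?P = "list_pmf ?ps"
  have fs: "fin_supp ?ps" by simp
  then have fin: "finite (set_pmf ?P)" by simp
  \<comment> \<open>The at most 18 n arrivals give a standard deviation of at most 5 N^2, since n =
    N^4. This is small against the window of N^3 private arrivals.\<close>
  define \<sigma> where "\<sigma> = 5 * real N ^ 2"
  have "\<sigma> > 0" using N by (simp add: \<sigma>_def)
  have "real (l + k) \<le> 25 * real n" using l k by linarith
  then have len: "real (length ?ps) * 1\<^sup>2 \<le> \<sigma>\<^sup>2"
    by (simp add: \<sigma>_def n_def power_mult_distrib flip: power_mult)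
  let ?a = "mean_unsat n l k" and ?b = "mean_unsat n (l + ?K) k"
  have dev1: "expect ?P (\<lambda>xs. \<bar>unsat n xs - ?a\<bar>) \<le> \<sigma>"
    using abs_deviation_list_pmf[OF fs _ len \<open>\<sigma> > 0\<close>, of "unsat n"] unsat_change_one[OF n]
    by (simp add: mean_unsat_def)
  have dev2: "expect ?P (\<lambda>xs. \<bar>unsat_after n ?K xs - ?b\<bar>) \<le> \<sigma>"
    using abs_deviation_list_pmf[OF fs _ len \<open>\<sigma> > 0\<close>, of "unsat_after n ?K"]
      unsat_after_change_one[OF n]
    by (simp add: mean_unsat_add_loops[OF n])
  \<comment> \<open>\<open>z\<close> is the realised slope over the window, and \<open>e\<close>
    bounds how far it can fall below the mean slope \<open>m\<close>.\<close>
  define z where "z xs = (unsat n xs - unsat_after n ?K xs) / ?K" for xs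
  define e where "e xs = (\<bar>unsat n xs - ?a\<bar> + \<bar>unsat_after n ?K xs - ?b\<bar>) / ?K" for xs
  have K: "real ?K > 0" using N by simp
  have z0: "0 \<le> z xs" for xs
    using unsat_after_le[OF n, of ?K xs] K by (simp add: z_def)
  have zy: "z xs \<le> core_frac n xs" for xs
    using unsat_after_ge[OF n, of xs ?K] K by (simp add: z_def divide_le_eq mult.commute)
  have e0: "0 \<le> e xs" for xs by (simp add: e_def)
  have mz: "m - z xs \<le> e xs" for xs
  proof -
    have "m - z xs = ((?a - unsat n xs) + (unsat_after n ?K xs - ?b)) / ?K"
      by (simp add: m_def z_def diff_divide_distrib add_divide_distrib)
    also have "\<dots> \<le> e xs" unfolding e_def by (intro divide_right_mono) auto
    finally show ?thesis .
  qed
  \<comment> \<open>The factor 41/40 = 1/8 + 3 * 3/10 is a Lipschitz constant of the decrease as a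
    function of the core fraction.\<close>
  have pt: "y / 8 + 3 / 10 * (1 - (1 - y) ^ 3) - 41 / 40 * (e xs + 12 / N)
      \<le> core_frac n xs / 8 + 3 / 10 * (1 - (1 - core_frac n xs) ^ 3)" for xs
  proof -
    have d: "y - (e xs + 12 / N) \<le> core_frac n xs" using mz[of xs] zy[of xs] m by linarith
    have "(1 - core_frac n xs) ^ 3 \<le> (1 - y) ^ 3 + 3 * (e xs + 12 / N)"
      using d e0[of xs] y core_frac_bounds[OF n, of xs] by (intro cube_lipschitz) auto
    moreover have "y / 8 + 3 / 10 * (1 - Y) - 41 / 40 * g \<le> c / 8 + 3 / 10 * (1 - C)"
      if "y - g \<le> c" "C \<le> Y + 3 * g" for c C Y g :: real
      using that by argo
    ultimately show ?thesis using d by blast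
  qed
  have "y / 8 + 3 / 10 * (1 - (1 - y) ^ 3) - 41 / 40 * (expect ?P e + 12 / N)
      = expect ?P (\<lambda>xs. y / 8 + 3 / 10 * (1 - (1 - y) ^ 3) - 41 / 40 * (e xs + 12 / N))"
    using fin by (simp add: expect_diff expect_add)
  also have "\<dots> \<le> expect ?P (\<lambda>xs. core_frac n xs / 8 + 3 / 10 * (1 - (1 - core_frac n
      xs) ^ 3))"
    by (intro expect_mono fin pt)
  finally have main: "mean_unsat n l (Suc k) \<le> ?a - (y / 8 + 3 / 10 * (1 - (1 - y) ^ 3))
      + 41 / 40 * (expect ?P e + 12 / N)"
    unfolding mean_unsat_Suc[OF n] by linarith
  have "expect ?P e = (expect ?P (\<lambda>xs. \<bar>unsat n xs - ?a\<bar>) + expect ?P (\<lambda>xs.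
      \<bar>unsat_after n ?K xs - ?b\<bar>)) / ?K"
    unfolding e_def[abs_def] using fin by (simp add: expect_add)
  also have "\<dots> \<le> (\<sigma> + \<sigma>) / ?K"
    using dev1 dev2 by (intro divide_right_mono) auto
  also have "\<dots> = 10 / N"
    using N by (simp add: \<sigma>_def power2_eq_square power3_eq_cube field_simps)
  finally have "41 / 40 * (expect ?P e + 12 / N) \<le> 41 / 40 * (22 / N)"
    by (intro mult_left_mono) (simp_all add: add_divide_distrib[symmetric])
  also have "\<dots> \<le> 23 / N" using N by (simp add: field_simps)
  finally show ?thesis using main by linarith
qed

section \<open>The Hamilton--Jacobi bound\<close>

text \<open>For fixed \<^term>\<open>y\<close>, \<^term>\<open>plane y\<close> is the linear solution of
    \<open>T\<^sub>\<rho> = (1 + T\<^sub>r)\<^sup>3 - 1\<close> that is tangent to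
  \<open>e\<^sup>-\<^sup>r\<close> at \<open>\<rho> = 0\<close>; Hopf's solution is the maximum of these
      planes. For \<open>\<rho> < 2/3\<close> the maximiser is
  the unique \<^term>\<open>y\<close> with \<^term>\<open>foot \<rho> y = r\<close>.\<close>

definition plane :: "real \<Rightarrow> real \<Rightarrow> real \<Rightarrow> real" where
  "plane y r \<rho> = y * (1 - ln y) - y * r - \<rho> * (1 - (1 - y) ^ 3)"

definition foot :: "real \<Rightarrow> real \<Rightarrow> real" where
  "foot \<rho> y = - ln y - 3 * \<rho> * (1 - y)\<^sup>2"

definition slope :: "real \<Rightarrow> real \<Rightarrow> real" where
  "slope r \<rho> = (SOME y. 0 < y \<and> y \<le> 1 \<and> foot \<rho> y = r)"

definition envelope :: "real \<Rightarrow> real \<Rightarrow> real" where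
  "envelope r \<rho> = plane (slope r \<rho>) r \<rho>"

text \<open>The derivative of \<open>foot\<close> in \<open>y\<close> is - 1/y + 6 \<rho> (1 - y),
  and 6 \<rho> y (1 - y) is at most 9/10 for \<rho> up to 3/5. Thus characteristics do not cross,
  and \<open>slope\<close> is Lipschitz in \<open>r\<close> with constant 10.\<close>

lemma foot_gap:
  assumes "0 \<le> \<rho>" "\<rho> \<le> 3 / 5" "0 < a" "a \<le> b" "b \<le> 1"
  shows "foot \<rho> b + (b - a) / 10 \<le> foot \<rho> a"
proof -
  have "foot \<rho> b + b / 10 \<le> foot \<rho> a + a / 10"
  proof (rule DERIV_nonpos_imp_nonincreasing[OF \<open>a \<le> b\<close>])
    fix x assume x: "a \<le> x" "x \<le> b"
    then have x01: "0 < x" "x \<le> 1" using assms by auto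
    have "((\<lambda>x. foot \<rho> x + x / 10) has_real_derivative (- (1 / x) + 6 * \<rho> * (1 - x) + 1
        / 10)) (at x)"
      unfolding foot_def using x01 by (auto intro!: derivative_eq_intros simp: field_simps)
    moreover have "- (1 / x) + 6 * \<rho> * (1 - x) + 1 / 10 \<le> 0"
    proof -
      have "6 * \<rho> * (x * (1 - x)) \<le> 6 * (3 / 5) * (x * (1 - x))"
        using assms x01 by (intro mult_right_mono) auto
      moreover have "x * (1 - x) \<le> 1 / 4" using zero_le_power2[of "x - 1 / 2"]
        by (simp add: power2_eq_square algebra_simps)
      ultimately have "x * (6 * \<rho> * (1 - x) + 1 / 10) \<le> 1" using x01 by (simp add: algebra_simps)
      then have "6 * \<rho> * (1 - x) + 1 / 10 \<le> 1 / x" using x01 by (simp add: field_simps)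
      then show ?thesis by simp
    qed
    ultimately show "\<exists>y. ((\<lambda>x. foot \<rho> x + x / 10) has_real_derivative y) (at x)
        \<and> y \<le> 0"
      by blast
  qed
  then show ?thesis by (simp add: field_simps)
qed

lemma slope:
  assumes "0 \<le> r" "0 \<le> \<rho>" "\<rho> \<le> 3 / 5"
  shows "0 < slope r \<rho>" "slope r \<rho> \<le> 1" "foot \<rho> (slope r \<rho>) = r"
proof -
  \<comment> \<open>At this left end the logarithm contributes \<open>r + 2\<close>, and the
    subtracted term of \<open>foot\<close> is at most 9/5.\<close>
  let ?a = "exp (- r - 2)"
  have a: "0 < ?a" "?a \<le> 1" using assms by auto
  have "(1 - ?a)\<^sup>2 \<le> 1" using a by (intro power_le_one) auto
  then have "3 * \<rho> * (1 - ?a)\<^sup>2 \<le> (9 / 5) * 1" using assms by (intro mult_mono) auto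
  then have "r \<le> foot \<rho> ?a" by (simp add: foot_def)
  moreover have "foot \<rho> 1 \<le> r" using assms by (simp add: foot_def)
  moreover have "continuous_on {?a..1} (foot \<rho>)"
    unfolding foot_def[abs_def] using a by (intro continuous_intros) (use order_less_le_trans in force)
  ultimately obtain y where "?a \<le> y" "y \<le> 1" "foot \<rho> y = r"
    using IVT2'[of "foot \<rho>" 1 r ?a] a by blast
  then have "\<exists>y. 0 < y \<and> y \<le> 1 \<and> foot \<rho> y = r" using a(1) by (intro exI[of _
      y]) (meson less_le_trans)
  from someI_ex[OF this] show "0 < slope r \<rho>" "slope r \<rho> \<le> 1" "foot \<rho> (slope r \<rho>) = r"
    unfolding slope_def by auto
qed

lemma DERIV_plane:
  assumes "0 < y"
  shows "((\<lambda>y. plane y r \<rho>) has_real_derivative (foot \<rho> y - r)) (at y)"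
  unfolding plane_def foot_def using assms
  by (auto intro!: derivative_eq_intros simp: field_simps power2_eq_square)

text \<open>By \<open>DERIV_plane\<close> and the monotonicity of \<open>foot\<close>, the plane
  grows with its parameter up to \<open>slope\<close> and decreases afterwards.\<close>

lemma plane_le_envelope:
  assumes "0 \<le> r" "0 \<le> \<rho>" "\<rho> \<le> 3 / 5" "0 < y" "y \<le> 1"
  shows "plane y r \<rho> \<le> envelope r \<rho>"
proof -
  note s = slope[OF assms(1-3)]
  let ?s = "slope r \<rho>"
  show ?thesis
  proof (cases "y \<le> ?s")
    case True
    show ?thesis unfolding envelope_def
    proof (rule DERIV_nonneg_imp_nondecreasing[OF True])
      fix x assume x: "y \<le> x" "x \<le> ?s"
      then have "foot \<rho> ?s + (?s - x) / 10 \<le> foot \<rho> x" using assms s by (intro foot_gap) auto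
      then have "foot \<rho> x - r \<ge> 0" using s x by (simp add: field_simps)
      moreover have "((\<lambda>y. plane y r \<rho>) has_real_derivative (foot \<rho> x - r)) (at x)"
        using assms x by (intro DERIV_plane) auto
      ultimately show "\<exists>z. ((\<lambda>y. plane y r \<rho>) has_real_derivative z) (at x) \<and> z
          \<ge> 0" by blast
    qed
  next
    case False
    then have le: "?s \<le> y" by simp
    show ?thesis unfolding envelope_def
    proof (rule DERIV_nonpos_imp_nonincreasing[OF le])
      fix x assume x: "?s \<le> x" "x \<le> y"
      then have "foot \<rho> x + (x - ?s) / 10 \<le> foot \<rho> ?s" using assms s by (intro foot_gap) auto
      then have "foot \<rho> x - r \<le> 0" using s x by (simp add: field_simps)
      moreover have "((\<lambda>y. plane y r \<rho>) has_real_derivative (foot \<rho> x - r)) (at x)"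
        using s x by (intro DERIV_plane) auto
      ultimately show "\<exists>z. ((\<lambda>y. plane y r \<rho>) has_real_derivative z) (at x) \<and> z
          \<le> 0" by blast
    qed
  qed
qed

text \<open>The equation \<open>foot \<rho> y = r\<close> eliminates both the logarithm and
  \<open>r\<close>.\<close>

lemma envelope_eq:
  assumes "0 \<le> r" "0 \<le> \<rho>" "\<rho> \<le> 3 / 5" "y = slope r \<rho>"
  shows "envelope r \<rho> = y - \<rho> * (3 * y\<^sup>2 - 2 * y ^ 3)"
proof -
  have ln: "ln y = - r - 3 * \<rho> * (1 - y)\<^sup>2"
    using slope(3)[OF assms(1-3)] assms(4) by (simp add: foot_def)
  show ?thesis unfolding envelope_def plane_def assms(4)[symmetric] ln
    by (simp add: power2_eq_square power3_eq_cube algebra_simps)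
qed

lemma envelope_nonneg:
  assumes "0 \<le> r" "0 \<le> \<rho>" "\<rho> \<le> 3 / 5"
  shows "0 \<le> envelope r \<rho>"
proof -
  define y where "y = slope r \<rho>"
  have y: "0 < y" "y \<le> 1" using slope[OF assms] by (auto simp: y_def)
  have q: "y * (3 - 2 * y) \<le> 9 / 8" using zero_le_power2[of "y - 3 / 4"]
    by (simp add: power2_eq_square algebra_simps)
  have "\<rho> * (y * (3 - 2 * y)) \<le> 3 / 5 * (9 / 8)"
    using q assms y by (intro mult_mono) auto
  then have "0 \<le> y * (1 - \<rho> * (y * (3 - 2 * y)))" using y by (intro mult_nonneg_nonneg) auto
  then show ?thesis
    unfolding envelope_eq[OF assms y_def] by (simp add: power2_eq_square power3_eq_cube algebra_simps)
qed

text \<open>The plane that is maximal at \<open>r + d\<close> is also below the envelope at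
  \<open>r\<close>, and by \<open>foot_gap\<close> its parameter is smaller than the old slope by at
  most 10 d.\<close>

lemma envelope_shift:
  assumes "0 \<le> r" "0 \<le> \<rho>" "\<rho> \<le> 3 / 5" "0 \<le> d"
  shows "envelope (r + d) \<rho> \<le> envelope r \<rho> - d * slope r \<rho> + 10 * d\<^sup>2"
proof -
  have rd: "0 \<le> r + d" using assms by simp
  note s = slope[OF assms(1-3)] and s' = slope[OF rd assms(2,3)]
  let ?y = "slope r \<rho>" and ?z = "slope (r + d) \<rho>"
  have "?y - ?z \<le> 10 * d"
  proof (cases "?z \<le> ?y")
    case True
    then have "foot \<rho> ?y + (?y - ?z) / 10 \<le> foot \<rho> ?z" using assms s s' by (intro foot_gap) auto
    then show ?thesis using s s' by simp
  qed (use assms in auto)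
  then have "d * (?y - ?z) \<le> d * (10 * d)" using assms by (intro mult_left_mono) auto
  moreover have "envelope (r + d) \<rho> = plane ?z r \<rho> - d * ?z"
    by (simp add: envelope_def plane_def algebra_simps)
  moreover have "plane ?z r \<rho> \<le> envelope r \<rho>" using assms s' by (intro plane_le_envelope) auto
  ultimately show ?thesis by (simp add: power2_eq_square algebra_simps)
qed

text \<open>The plane touching the envelope at the old point stays below it at the new
  point.\<close>

lemma envelope_forward:
  assumes "0 \<le> r" "0 \<le> \<rho>" "0 \<le> d" "0 \<le> e" "\<rho> + e \<le> 3 / 5"
  shows "envelope r \<rho> - (d * slope r \<rho> + e * (1 - (1 - slope r \<rho>) ^ 3)) \<le> envelope (r
      + d) (\<rho> + e)"
proof -
  have \<rho>: "\<rho> \<le> 3 / 5" using assms by simp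
  note s = slope[OF assms(1,2) \<rho>]
  have "plane (slope r \<rho>) (r + d) (\<rho> + e) \<le> envelope (r + d) (\<rho> + e)"
    using assms s by (intro plane_le_envelope) auto
  then show ?thesis by (simp add: envelope_def plane_def algebra_simps)
qed

lemma exp_le_envelope:
  assumes "0 \<le> r"
  shows "exp (- r) \<le> envelope r 0"
  using plane_le_envelope[of r 0 "exp (- r)"] assms by (simp add: plane_def algebra_simps)

lemma exp_ge_partial_sum:
  fixes x :: real
  assumes "0 \<le> x"
  shows "(\<Sum>i<m. x ^ i / fact i) \<le> exp x"
proof -
  have "(\<Sum>i<m. x ^ i /\<^sub>R fact i) \<le> (\<Sum>i. x ^ i /\<^sub>R fact i)"
    using assms by (intro sum_le_suminf summable_exp_generic) auto
  then show ?thesis by (simp add: exp_def divide_inverse mult.commute)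
qed

text \<open>The point reached after all \<open>2 * n\<close> arrivals of the instance. It suffices
  to bound the slope there by 19/40, since the formula of \<open>envelope_eq\<close> increases with
  the slope.\<close>

lemma envelope_quarter: "envelope (1 / 4) (3 / 5) \<le> 79 / 400"
proof -
  define y where "y = slope (1 / 4) (3 / 5)"
  have s: "0 < y" "y \<le> 1" "foot (3 / 5) y = 1 / 4" using slope[of "1 / 4" "3 / 5"] by (auto simp: y_def)
  let ?b = "19 / 40 :: real"
  \<comment> \<open>5969/8000 is 1/4 + 9/5 * (21/40)^2, so this says that the characteristic with
    parameter 19/40 starts at or below 1/4.\<close>
  have "40 / 19 \<le> exp (5969 / 8000 :: real)"
  proof -
    have "(\<Sum>i<5. (5969 / 8000 :: real) ^ i / fact i) \<le> exp (5969 / 8000)"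
      by (rule exp_ge_partial_sum) simp
    then show ?thesis by (simp add: eval_nat_numeral fact_numeral)
  qed
  then have "ln (40 / 19 :: real) \<le> ln (exp (5969 / 8000))" by (subst ln_le_cancel_iff) auto
  then have "ln (40 / 19 :: real) \<le> 5969 / 8000" by simp
  then have fb: "foot (3 / 5) ?b \<le> 1 / 4"
    by (simp add: foot_def ln_div power2_eq_square)
  have "y \<le> ?b"
  proof (rule ccontr)
    assume "\<not> y \<le> ?b"
    then have "foot (3 / 5) y + (y - ?b) / 10 \<le> foot (3 / 5) ?b" using s by (intro foot_gap) auto
    then show False using fb s(3) \<open>\<not> y \<le> ?b\<close> by argo
  qed
  \<comment> \<open>Monotonicity, in the form of a factored difference of the values at
    \<open>?b\<close> and \<open>y\<close>.\<close>
  have "0 \<le> (?b - y) * (1 - 3 / 5 * (3 * (?b + y) - 2 * (?b * ?b + ?b * y + y * y)))"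
  proof (intro mult_nonneg_nonneg)
    have "3 * (?b + y) - 2 * (?b * ?b + ?b * y + y * y) \<le> 3 / 2"
      using zero_le_power2[of "?b + y - 1"] zero_le_power2[of "?b - y"]
      by (simp add: power2_eq_square algebra_simps)
    then show "0 \<le> 1 - 3 / 5 * (3 * (?b + y) - 2 * (?b * ?b + ?b * y + y * y))" by simp
  qed (use \<open>y \<le> ?b\<close> in simp)
  also have "(b - y) * (1 - 3 / 5 * (3 * (b + y) - 2 * (b * b + b * y + y * y)))
      = b - 3 / 5 * (3 * b\<^sup>2 - 2 * b ^ 3) - (y - 3 / 5 * (3 * y\<^sup>2 - 2 * y ^ 3))" for b
    by (simp add: power2_eq_square power3_eq_cube field_simps)
  finally have "y - 3 / 5 * (3 * y\<^sup>2 - 2 * y ^ 3) \<le> ?b - 3 / 5 * (3 * ?b\<^sup>2 - 2 * ?b ^ 3)"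
    by linarith
  also have "\<dots> \<le> 79 / 400" by (simp add: power2_eq_square power3_eq_cube)
  finally show ?thesis using envelope_eq[of "1 / 4" "3 / 5" y] by (simp add: y_def)
qed

section \<open>Comparison of the mean deficiency with the envelope\<close>

lemma mean_unsat_large:
  assumes "n > 0" "16 * n \<le> l"
  shows "mean_unsat n l k \<le> n / 65536"
proof -
  have "(1 - 1 / n) ^ l \<le> exp (- (1 / n)) ^ l"
    using assms exp_ge_add_one_self[of "- (1 / n)"] by (intro power_mono) auto
  also have "\<dots> = exp (- (l / n))" by (simp flip: exp_of_nat_mult)
  also have "\<dots> \<le> exp (- 16)"
  proof -
    have "real (16 * n) \<le> real l" using assms(2) by (simp only: of_nat_le_iff)
    then show ?thesis using assms(1) by (simp add: field_simps)
  qed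
  also have "\<dots> \<le> 1 / 65536"
  proof -
    have "(2 :: real) ^ 16 \<le> exp 1 ^ 16"
      using exp_ge_add_one_self[of 1] by (intro power_mono) auto
    then have "65536 \<le> exp (16 :: real)" by (simp flip: exp_of_nat_mult)
    then show ?thesis by (simp add: exp_minus field_simps)
  qed
  finally have "n * (1 - 1 / n) ^ l \<le> n * (1 / 65536)" by (intro mult_left_mono) auto
  then show ?thesis
    using mean_unsat_0[OF assms(1), of l] mean_unsat_le_0[OF assms(1), of l k] by simp
qed

text \<open>A discrete maximum principle for the Hamilton--Jacobi equation
  \<open>T\<^sub>\<rho> = (1 + T\<^sub>r)\<^sup>3 - 1\<close>: where the excess over the envelope is
      nearly maximal, its slope in the
  direction of further private arrivals is controlled from one side, which is all that
  \<open>mean_unsat_step\<close> needs.\<close>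

lemma mean_unsat_le_envelope:
  fixes N k :: nat
  defines "n \<equiv> N ^ 4"
  assumes N: "N > 0" and k: "k \<le> 2 * n"
  shows "mean_unsat n l k \<le> real n * envelope (real l / real n + real k / (8 * real n))
    (3 * real k / (10 * real n)) + real n / 65536 + real k * (23 / real N)"
  using k
proof (induction k arbitrary: l)
  case 0
  have n: "n > 0" using N by (simp add: n_def)
  have "(1 - 1 / n) ^ l \<le> exp (- (1 / n)) ^ l"
    using n exp_ge_add_one_self[of "- (1 / n)"] by (intro power_mono) auto
  also have "\<dots> = exp (- (l / n))" by (simp flip: exp_of_nat_mult)
  also have "\<dots> \<le> envelope (l / n) 0" by (rule exp_le_envelope) simp
  finally have "n * (1 - 1 / n) ^ l \<le> n * envelope (l / n) 0" by (intro mult_left_mono) auto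
  then show ?case using mean_unsat_0[OF n, of l] by simp
next
  case (Suc k)
  have n: "n > 0" using N by (simp add: n_def)
  define r where "r = l / n + k / (8 * n)"
  define \<rho> where "\<rho> = 3 * k / (10 * n)"
  define y where "y = slope r \<rho>"
  define X where "X = n / 65536 + k * (23 / N)"
  define d where "d = 1 / (8 * n)"
  define e where "e = 3 / (10 * n)"
  have r0: "0 \<le> r" and \<rho>0: "0 \<le> \<rho>" and d0: "0 \<le> d" and e0: "0 \<le> e"
    by (simp_all add: r_def \<rho>_def d_def e_def)
  have "real (Suc k) \<le> 2 * n" using Suc.prems by linarith
  then have \<rho>e: "\<rho> + e \<le> 3 / 5" using n by (simp add: \<rho>_def e_def field_simps)
  then have \<rho>1: "\<rho> \<le> 3 / 5" using e0 by simp
  have y: "0 \<le> y" "y \<le> 1" using slope[OF r0 \<rho>0 \<rho>1] by (auto simp: y_def)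
  have eqs: "real l / real n + real (Suc k) / (8 * real n) = r + d"
    "3 * real (Suc k) / (10 * real n) = \<rho> + e"
    by (simp_all add: r_def \<rho>_def d_def e_def add_divide_distrib)
  define g where "g = y / 8 + 3 / 10 * (1 - (1 - y) ^ 3)"
  have "0 \<le> (1 - y) ^ 3" using y by (intro zero_le_power) simp
  then have g1: "g \<le> 1" using y unfolding g_def by argo
  have ng: "n * (d * y + e * (1 - (1 - y) ^ 3)) = g"
    using n by (simp add: d_def e_def g_def field_simps)
  have fwd: "n * envelope r \<rho> - g \<le> n * envelope (r + d) (\<rho> + e)"
    using mult_left_mono[OF envelope_forward[OF r0 \<rho>0 d0 e0 \<rho>e, folded y_def], of "real n"] ng
    by (simp add: algebra_simps)
  have goal: "mean_unsat n l (Suc k) \<le> n * envelope (r + d) (\<rho> + e) + X + 23 / N"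
  proof (cases "16 * n \<le> l")
    \<comment> \<open>Outside the range of \<open>l\<close> covered by
      \<open>mean_unsat_step\<close>, the mean is below the error term n/65536 by
      \<open>mean_unsat_large\<close>.\<close>
    case True
    have "0 \<le> n * envelope (r + d) (\<rho> + e)"
      using r0 \<rho>0 d0 e0 \<rho>e by (intro mult_nonneg_nonneg envelope_nonneg) auto
    moreover have "0 \<le> k * (23 / N)" "0 \<le> 23 / real N" by auto
    ultimately show ?thesis using mean_unsat_large[OF n True, of "Suc k"] unfolding X_def by linarith
  next
    case l: False
    show ?thesis
    proof (cases "mean_unsat n l k \<le> n * envelope r \<rho> + X - 1")
      case True
      \<comment> \<open>One arrival lowers the bound by at most \<open>g\<close>, which is at most
        1, so a value that is one below the bound cannot overtake it.\<close>
      then have "mean_unsat n l (Suc k) \<le> n * envelope r \<rho> + X - g"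
        using mean_unsat_mono[OF n, of l k] g1 by linarith
      moreover have "0 \<le> 23 / real N" by simp
      ultimately show ?thesis using fwd by linarith
    next
      case False
      \<comment> \<open>The excess is now within 1 of its bound. The induction hypothesis at
        \<open>l + ?K\<close>, where \<open>r\<close> grows by 1/N, then forces the mean slope to be
        at least \<open>y - 12 / N\<close>: \<open>envelope_shift\<close> costs 10/N, and the gap of
        1 costs at most 2/N.\<close>
      let ?K = "N ^ 3"
      have k': "k \<le> 2 * n" using Suc.prems by simp
      have shift: "(real l + real N ^ 3) / real n + real k / (8 * real n) = r + 1 / real N"
        using N by (simp add: r_def n_def add_divide_distrib power3_eq_cube power4_eq_xxxx)
      have "mean_unsat n (l + ?K) k \<le> n * envelope (r + 1 / N) \<rho> + X"
        using Suc.IH[OF k', of "l + ?K"] by (simp add: X_def \<rho>_def shift)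
      also have "n * envelope (r + 1 / N) \<rho> \<le> n * (envelope r \<rho> - 1 / N * y + 10 * (1 /
          N)\<^sup>2)"
        unfolding y_def by (intro mult_left_mono envelope_shift r0 \<rho>0 \<rho>1) auto
      finally have "mean_unsat n l k - mean_unsat n (l + ?K) k \<ge> n * (1 / N * y - 10 * (1 /
          N)\<^sup>2) - 1"
        using False by (simp add: algebra_simps)
      also have "n * (1 / N * y - 10 * (1 / N)\<^sup>2) - 1 \<ge> ?K * (y - 12 / N)"
      proof -
        have "n * (1 / N * y - 10 * (1 / N)\<^sup>2) = ?K * (y - 10 / N)"
          using N by (simp add: n_def power2_eq_square power3_eq_cube power4_eq_xxxx field_simps)
        moreover have "1 \<le> ?K * (2 / N)"
        proof -
          have "1 \<le> N * N" using N by simp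
          then have "1 \<le> real (N * N)" by linarith
          then show ?thesis using N by (simp add: power3_eq_cube)
        qed
        moreover have "?K * (y - 12 / N) = ?K * (y - 10 / N) - ?K * (2 / N)"
          by (simp add: algebra_simps flip: diff_divide_distrib)
        ultimately show ?thesis by linarith
      qed
      finally have m: "y - 12 / N \<le> (mean_unsat n l k - mean_unsat n (l + ?K) k) / ?K"
        using N by (simp add: pos_le_divide_eq mult.commute)
      have "mean_unsat n l (Suc k) \<le> mean_unsat n l k - g + 23 / N"
        unfolding g_def n_def
      proof (rule mean_unsat_step)
        show "y - 12 / N \<le> (mean_unsat (N ^ 4) l k - mean_unsat (N ^ 4) (l + N ^ 3) k) / real (N ^ 3)"
          using m by (simp add: n_def)
      qed (use N y l Suc.prems in \<open>auto simp: n_def\<close>)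
      also have "mean_unsat n l k \<le> n * envelope r \<rho> + X"
        using Suc.IH[OF k', of l] by (simp add: X_def r_def \<rho>_def)
      finally show ?thesis using fwd by linarith
    qed
  qed
  then show ?case unfolding eqs X_def by (simp add: add_divide_distrib algebra_simps)
qed

corollary mean_unsat_final:
  fixes N :: nat
  defines "n \<equiv> N ^ 4"
  assumes N: "N > 0"
  shows "mean_unsat n 0 (2 * n) \<le> n * (79 / 400 + 1 / 65536 + 46 / N)"
proof -
  have n: "n > 0" using N by (simp add: n_def)
  have "mean_unsat n 0 (2 * n) \<le> n * envelope (1 / 4) (3 / 5) + n / 65536 + 2 * n * (23 / N)"
    using mean_unsat_le_envelope[OF N, of "2 * n" 0] n by (simp flip: n_def)
  also have "n * envelope (1 / 4) (3 / 5) \<le> n * (79 / 400)"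
    by (intro mult_left_mono envelope_quarter) auto
  finally show ?thesis by (simp add: algebra_simps)
qed

section \<open>The offline optimum\<close>

definition inst_I :: "nat \<Rightarrow> nat set" where
  "inst_I n = to_nat ` set_pmf (arr n)"

definition inst_E :: "nat \<Rightarrow> (nat \<times> nat) set" where
  "inst_E n = {(to_nat t, j) | t j. t \<in> set_pmf (arr n) \<and> j \<in> nbr n t}"

definition inst_w :: "nat \<Rightarrow> nat \<Rightarrow> real" where
  "inst_w i j = wt (from_nat i)"

definition inst_lam :: "nat \<Rightarrow> nat \<Rightarrow> real" where
  "inst_lam n i = 2 * n * pmf (arr n) (from_nat i)"

lemma types_pmf_map: "types_pmf (map_pmf f p) k = map_pmf (map f) (list_pmf (replicate k p))"
  by (induction k) (simp_all add: bind_map_pmf map_bind_pmf pmf.map_comp o_def)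

definition globs :: "ty list \<Rightarrow> real" where
  "globs xs = length (filter (\<lambda>t. t = Glob) xs)"

lemma globs_simps [simp]:
  "globs [] = 0" "globs (t # xs) = (if t = Glob then 1 else 0) + globs xs" "globs (xs @ ys) = globs xs +
      globs ys"
  by (auto simp: globs_def)

context
  fixes n :: nat
  assumes n: "n > 0"
begin

lemmas [simp] = finite_arr[OF n]

lemma arrival_pmf_inst: "arrival_pmf (inst_I n) (inst_lam n) (2 * n) = map_pmf to_nat (arr n)"
proof (rule pmf_eqI)
  fix i
  have eq: "(\<lambda>i. if i \<in> inst_I n then inst_lam n i / real (2 * n) else 0) = pmf (map_pmf
      to_nat (arr n))"
  proof
    fix i
    show "(if i \<in> inst_I n then inst_lam n i / real (2 * n) else 0) = pmf (map_pmf to_nat (arr n)) i"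
    proof (cases "i \<in> inst_I n")
      case True
      then obtain t :: ty where "i = to_nat t" by (auto simp: inst_I_def)
      then show ?thesis using True n by (simp add: inst_lam_def pmf_map_inj')
    next
      case False
      then have "i \<notin> set_pmf (map_pmf to_nat (arr n))" by (simp add: inst_I_def)
      then have "pmf (map_pmf to_nat (arr n)) i = 0" by (simp only: set_pmf_iff not_not)
      then show ?thesis using False by simp
    qed
  qed
  show "pmf (arrival_pmf (inst_I n) (inst_lam n) (2 * n)) i = pmf (map_pmf to_nat (arr n)) i"
    unfolding arrival_pmf_def eq by (subst pmf_embed_pmf) (auto simp: nn_integral_pmf_eq_1)
qed

lemma valid_inst: "valid_instance (inst_I n) {..<n} (inst_E n) inst_w (inst_lam n) (2 * n)"
  unfolding valid_instance_def
proof (intro conjI)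
  show "inst_E n \<subseteq> inst_I n \<times> {..<n}"
    using set_arr[OF n] by (auto simp: inst_E_def inst_I_def)
  have "wt t > 0" if "j \<in> nbr n t" for t j
    using that by (cases t) auto
  then show "\<forall>(i, j)\<in>inst_E n. inst_w i j > 0"
    by (auto simp: inst_E_def inst_w_def)
  show "\<forall>i\<in>inst_I n. inst_lam n i > 0"
    using n by (auto simp: inst_I_def inst_lam_def pmf_positive)
  have "(\<Sum>i\<in>inst_I n. inst_lam n i) = 2 * n * (\<Sum>t\<in>set_pmf (arr n). pmf (arr n) t)"
    unfolding inst_I_def by (subst sum.reindex) (auto simp: inst_lam_def sum_distrib_left)
  then show "(\<Sum>i\<in>inst_I n. inst_lam n i) = real (2 * n)"
    by (simp add: sum_pmf_eq_1)
qed (use n in \<open>auto simp: inst_I_def\<close>)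

lemma finite_inst_E: "finite (inst_E n)"
proof (rule finite_subset)
  show "inst_E n \<subseteq> inst_I n \<times> {..<n}" "finite (inst_I n \<times> {..<n})"
    using valid_inst by (simp_all add: valid_instance_def)
qed

text \<open>A nonempty set meets every global arrival, so its surplus drops by their number; the
  empty set has surplus zero.\<close>

lemma deficiency_full_le:
  "real_of_int (deficiency (nbr n) {..<n} xs) \<le> max 0 (unsat n xs - globs xs)"
proof -
  obtain S where S: "S \<subseteq> {..<n}" "surplus (nbr n) xs S = deficiency (nbr n) {..<n} xs"
    by (rule deficiency_attained[OF finite_lessThan])
  show ?thesis
  proof (cases "S = {}")
    case True
    then show ?thesis using S(2) by (simp add: surplus_def)
  next
    case False
    then have "{..<n} \<inter> S \<noteq> {}" using S by blast
    then have meets: "(if nbr n t \<inter> S \<noteq> {} then 1 else 0) \<ge>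
        (if nbr_pt t \<inter> S \<noteq> {} then 1 else 0) + (if t = Glob then 1 else (0::nat))" for t
      by (cases t) auto
    have "length (filter (\<lambda>t. nbr_pt t \<inter> S \<noteq> {}) xs) + length (filter (\<lambda>t.
        t = Glob) xs)
        \<le> length (filter (\<lambda>t. nbr n t \<inter> S \<noteq> {}) xs)"
    proof (induction xs)
      case (Cons t xs)
      then show ?case using meets[of t] by (simp split: if_splits)
    qed simp
    then have "real_of_int (surplus (nbr n) xs S) \<le> real_of_int (surplus nbr_pt xs S) - globs xs"
      by (simp add: surplus_def globs_def)
    also have "real_of_int (surplus nbr_pt xs S) \<le> unsat n xs"
      using surplus_le_deficiency[OF finite_lessThan S(1), of nbr_pt xs] by (simp add: unsat_def)
    finally show ?thesis using S(2) by simp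
  qed
qed

text \<open>A maximum matching is overridden by a rare arrival at each vertex of \<open>H\<close>
  and by a private one at each vertex of \<open>P - H\<close>. At most one old edge is lost per
  vertex of these sets, and every surviving edge has weight 1.\<close>

lemma opt_val_lower:
  assumes xs: "set xs \<subseteq> set_pmf (arr n)"
  defines "P \<equiv> {j. j < n \<and> Priv j \<in> set xs}" and "H \<equiv> {j. j < n \<and> High j
      \<in> set xs}"
  shows "n - max 0 (unsat n xs - globs xs) + card P / 5 + (highW - 6 / 5) * card H
    \<le> opt_val (inst_E n) inst_w (map to_nat xs)"
proof -
  have loop: "nbr n (Priv v) = {v}" for v by simp
  obtain M where M: "matches (nbr n) {..<n} xs M"
    "int (card M) = int (card {..<n}) - deficiency (nbr n) {..<n} xs"
    by (rule hall_deficiency[where nb = "nbr n" and J = "{..<n}" and loop = Priv and xs = xs,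
          OF finite_lessThan loop])
  have finM: "finite M" using matches_finite[OF finite_lessThan M(1)] .
  have M1: "k < length xs" "j \<in> nbr n (xs ! k)" "j < n" if "(k, j) \<in> M" for k j
    using M(1) that by (auto simp: matches_def)
  have M2: "k = k' \<longleftrightarrow> j = j'" if "(k, j) \<in> M" "(k', j') \<in> M" for k j k' j'
    using M(1) that unfolding matches_def by blast
  have finH: "finite H" "finite P" by (auto simp: H_def P_def)
  have "\<exists>k. k < length xs \<and> xs ! k = High j" if "j \<in> H" for j
    using that by (auto simp: H_def in_set_conv_nth)
  then obtain kh where kh: "\<And>j. j \<in> H \<Longrightarrow> kh j < length xs \<and> xs ! kh j = High
      j" by metis
  have "\<exists>k. k < length xs \<and> xs ! k = Priv j" if "j \<in> P" for j
    using that by (auto simp: P_def in_set_conv_nth)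
  then obtain kp where kp: "\<And>j. j \<in> P \<Longrightarrow> kp j < length xs \<and> xs ! kp j = Priv
      j" by metis
  define A where "A = (\<lambda>j. (kh j, j)) ` H"
  define B where "B = (\<lambda>j. (kp j, j)) ` (P - H)"
  define C where "C = {(k, j) \<in> M. j \<notin> P \<union> H}"
  have finC: "finite C" unfolding C_def by (rule finite_subset[OF _ finM]) auto
  have fin: "finite A" "finite B" using finH by (auto simp: A_def B_def)
  \<comment> \<open>The vertices covered by \<open>C\<close> have no rare or private arrivals, so
    its arrivals are triples or global ones and none of them is reused from \<open>A\<close> or
    \<open>B\<close>.\<close>
  have Ctype: "xs ! k \<noteq> High v \<and> xs ! k \<noteq> Priv v \<and> wt (xs ! k) = 1" if "(k, j)
      \<in> C" for k j v
  proof -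
    have kj: "(k, j) \<in> M" "j \<notin> P" "j \<notin> H" using that by (auto simp: C_def)
    have mem: "xs ! k \<in> set xs" "j \<in> nbr n (xs ! k)" and "j < n" using M1[OF kj(1)] by auto
    have "t \<noteq> High v \<and> t \<noteq> Priv v \<and> wt t = 1" if "t \<in> set xs" "j \<in> nbr n
        t" for t
      by (cases t) (use that kj(2,3) \<open>j < n\<close> in \<open>auto simp: P_def H_def\<close>)
    from this[OF mem] show ?thesis .
  qed
  have AB: "A \<inter> B = {}" "(A \<union> B) \<inter> C = {}" by (auto simp: A_def B_def C_def)
  have matching: "is_matching (inst_E n) (map to_nat xs) (A \<union> B \<union> C)"
    unfolding is_matching_def
  proof
    have edge: "(to_nat (xs ! k), j) \<in> inst_E n" if "k < length xs" "j \<in> nbr n (xs ! k)" for k j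
    proof -
      have "xs ! k \<in> set_pmf (arr n)" using xs nth_mem[OF that(1)] by (rule subsetD)
      then show ?thesis using that(2) unfolding inst_E_def by blast
    qed
    have cls: "(xs ! k = High j \<and> k = kh j \<and> k < length xs) \<or> (xs ! k = Priv j \<and> k =
        kp j \<and> j \<in> P \<and> j \<notin> H \<and> k < length xs)
        \<or> (j \<notin> P \<and> (k, j) \<in> M \<and> (\<forall>v. xs ! k \<noteq> High v \<and> xs !
            k \<noteq> Priv v))"
      if "(k, j) \<in> A \<union> B \<union> C" for k j
    proof -
      consider "(k, j) \<in> A" | "(k, j) \<in> B" | "(k, j) \<in> C" using \<open>(k, j) \<in> A
          \<union> B \<union> C\<close> by blast
      then show ?thesis
      proof cases
        case 1
        then have "k = kh j" "j \<in> H" by (auto simp: A_def)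
        then show ?thesis using kh[of j] by simp
      next
        case 2
        then have "k = kp j" "j \<in> P" "j \<notin> H" by (auto simp: B_def)
        then show ?thesis using kp[of j] by simp
      next
        case 3
        then have "(k, j) \<in> M" "j \<notin> P" by (auto simp: C_def)
        moreover have "xs ! k \<noteq> High v \<and> xs ! k \<noteq> Priv v" for v using Ctype[OF 3, of
            v] by blast
        ultimately show ?thesis by blast
      qed
    qed
    show "A \<union> B \<union> C \<subseteq> {(k, j). k < length (map to_nat xs) \<and> (map to_nat xs !
        k, j) \<in> inst_E n}"
    proof (rule subsetI)
      fix p assume p: "p \<in> A \<union> B \<union> C"
      obtain k j where kj: "p = (k, j)" by (cases p)
      have "k < length xs \<and> j \<in> nbr n (xs ! k)"
        using cls[OF p[unfolded kj]]
      proof (elim disjE conjE)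
        assume "(k, j) \<in> M"
        then show ?thesis using M1[of k j] by blast
      qed simp_all
      then show "p \<in> {(k, j). k < length (map to_nat xs) \<and> (map to_nat xs ! k, j) \<in> inst_E n}"
        using edge[of k j] unfolding kj by simp
    qed
    have same_k: "j = j'" if "(k, j) \<in> A \<union> B \<union> C" "(k, j') \<in> A \<union> B \<union>
        C" for k j j'
    proof -
      have t: "xs ! k = High i \<or> xs ! k = Priv i \<or> ((k, i) \<in> M \<and> (\<forall>v. xs ! k
          \<noteq> High v \<and> xs ! k \<noteq> Priv v))"
        if "(k, i) \<in> A \<union> B \<union> C" for i
        using cls[OF that] by blast
      show ?thesis using t[OF that(1)] t[OF that(2)] M2[of k j k j'] by auto
    qed
    have same_j: "k = k'" if "(k, j) \<in> A \<union> B \<union> C" "(k', j) \<in> A \<union> B \<union>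
        C" for k k' j
    proof -
      consider "j \<in> H" | "j \<in> P - H" | "j \<notin> P \<union> H" by blast
      then show ?thesis
      proof cases
        case 1
        then have "k = kh j" "k' = kh j" using that by (auto simp: A_def B_def C_def)
        then show ?thesis by simp
      next
        case 2
        then have "k = kp j" "k' = kp j" using that by (auto simp: A_def B_def C_def)
        then show ?thesis by simp
      next
        case 3
        then have "(k, j) \<in> M" "(k', j) \<in> M" using that by (auto simp: A_def B_def C_def)
        then show ?thesis using M2[of k j k' j] by simp
      qed
    qed
    have uniq: "k = k' \<longleftrightarrow> j = j'" if "(k, j) \<in> A \<union> B \<union> C" "(k', j')
        \<in> A \<union> B \<union> C" for k j k' j'
      using same_k[of k j j'] same_j[of k j k'] that by blast
    show "\<forall>(k, j)\<in>A \<union> B \<union> C. \<forall>(k', j')\<in>A \<union> B \<union> C. (k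
        = k') = (j = j')"
      by (intro ballI case_prodI2) (rule uniq, simp_all only:)
  qed
  let ?val = "\<lambda>M. \<Sum>(k, j)\<in>M. inst_w (map to_nat xs ! k) j"
  have vA: "?val A = highW * card H"
  proof -
    have "?val A = (\<Sum>j\<in>H. inst_w (map to_nat xs ! kh j) j)"
      unfolding A_def by (subst sum.reindex) (auto simp: inj_on_def)
    also have "\<dots> = (\<Sum>j\<in>H. highW)"
      by (intro sum.cong refl) (use kh in \<open>simp add: inst_w_def\<close>)
    finally show ?thesis by simp
  qed
  have vB: "?val B = 6 / 5 * card (P - H)"
  proof -
    have "?val B = (\<Sum>j\<in>P - H. inst_w (map to_nat xs ! kp j) j)"
      unfolding B_def by (subst sum.reindex) (auto simp: inj_on_def)
    also have "\<dots> = (\<Sum>j\<in>P - H. 6 / 5)"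
      by (intro sum.cong refl) (use kp in \<open>simp add: inst_w_def\<close>)
    finally show ?thesis by simp
  qed
  have vC: "?val C = card C"
  proof -
    have "?val C = (\<Sum>(k, j)\<in>C. 1)"
    proof (intro sum.cong refl)
      fix p assume p: "p \<in> C"
      obtain k j where kj: "p = (k, j)" by (cases p)
      have "k < length xs" using p kj M1 by (auto simp: C_def)
      moreover have "wt (xs ! k) = 1" using Ctype[of k j 0] p kj by simp
      ultimately show "(case p of (k, j) \<Rightarrow> inst_w (map to_nat xs ! k) j) = (case p of (k, j)
          \<Rightarrow> 1)"
        by (simp add: kj inst_w_def)
    qed
    also have "\<dots> = (\<Sum>p\<in>C. 1)" by (intro sum.cong) auto
    finally show ?thesis by simp
  qed
  have cM: "real (card M) \<le> real (card C) + real (card (P \<union> H))"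
  proof -
    have "card (M - C) \<le> card (P \<union> H)"
    proof (rule card_inj_on_le[of snd])
      show "inj_on snd (M - C)" using M2 by (auto simp: inj_on_def)
      show "snd ` (M - C) \<subseteq> P \<union> H" by (auto simp: C_def)
    qed (use finH in auto)
    moreover have "C \<subseteq> M" by (auto simp: C_def)
    then have "card (M - C) = card M - card C" by (rule card_Diff_subset[OF finC])
    ultimately show ?thesis by linarith
  qed
  have PH: "real (card (P \<union> H)) = real (card H) + real (card (P - H))"
  proof -
    have "P \<union> H = H \<union> (P - H)" by blast
    moreover have "card (H \<union> (P - H)) = card H + card (P - H)"
      using finH by (intro card_Un_disjoint) auto
    ultimately show ?thesis by simp
  qed
  have "card P \<le> card (P \<union> H)"
    using finH by (intro card_mono) auto
  then have P: "real (card P) \<le> real (card (P \<union> H))" by simp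
  have cM': "real (card M) = n - real_of_int (deficiency (nbr n) {..<n} xs)"
  proof -
    have "real_of_int (int (card M)) = real_of_int (int n - deficiency (nbr n) {..<n} xs)"
      using M(2) by simp
    then show ?thesis by simp
  qed
  have low: "n - max 0 (unsat n xs - globs xs) + card P / 5 + (highW - 6 / 5) * card H
      \<le> highW * card H + 6 / 5 * card (P - H) + card C"
    using deficiency_full_le[of xs] cM PH P cM' by argo
  have "?val (A \<union> B \<union> C) = ?val (A \<union> B) + ?val C"
    by (rule sum.union_disjoint) (use fin finC AB in auto)
  moreover have "?val (A \<union> B) = ?val A + ?val B"
    by (rule sum.union_disjoint) (use fin AB in auto)
  ultimately have "?val (A \<union> B \<union> C) = ?val A + ?val B + ?val C" by simp
  then have "n - max 0 (unsat n xs - globs xs) + card P / 5 + (highW - 6 / 5) * card H \<le> ?val (A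
      \<union> B \<union> C)"
    using low unfolding vA vB vC by simp
  also have "\<dots> \<le> opt_val (inst_E n) inst_w (map to_nat xs)"
    unfolding opt_val_def
  proof (rule Max_ge)
    let ?X = "{..<length xs} \<times> {..<n}"
    have E: "inst_E n \<subseteq> inst_I n \<times> {..<n}" using valid_inst by (simp add: valid_instance_def)
    have "M' \<subseteq> ?X" if "is_matching (inst_E n) (map to_nat xs) M'" for M'
    proof (rule subsetI)
      fix p assume p: "p \<in> M'"
      obtain k j where kj: "p = (k, j)" by (cases p)
      have "p \<in> {(k, j). k < length (map to_nat xs) \<and> (map to_nat xs ! k, j) \<in> inst_E n}"
        using that p unfolding is_matching_def by (elim conjE) (erule subsetD)
      then show "p \<in> ?X" using E unfolding kj by auto
    qed
    then have "{\<Sum>(k, j)\<in>M'. inst_w (map to_nat xs ! k) j |M'. is_matching (inst_E n) (map to_nat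
        xs) M'}
        \<subseteq> ?val ` Pow ?X" by (intro subsetI, elim CollectE exE conjE) (simp only: image_eqI PowI)
    then show "finite {\<Sum>(k, j)\<in>M'. inst_w (map to_nat xs ! k) j |M'. is_matching (inst_E n) (map
        to_nat xs) M'}"
      by (rule finite_subset) auto
    show "?val (A \<union> B \<union> C) \<in> {\<Sum>(k, j)\<in>M'. inst_w (map to_nat xs ! k) j |M'.
        is_matching (inst_E n) (map to_nat xs) M'}"
      by (intro CollectI exI conjI) (rule refl, rule matching)
  qed
  finally show ?thesis .
qed

section \<open>Expectations of the terms in the offline bound\<close>

lemma expect_globs: "expect (list_pmf (replicate k (arr n))) globs = k * (99 / 1000)"
proof (induction k)
  case (Suc k)
  have fin: "finite (set_pmf (list_pmf (replicate k (arr n))))" by simp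
  have one: "expect (arr n) (\<lambda>t. if t = Glob then 1 else 0) = 99 / 1000"
    unfolding expect_arr[OF n] by simp
  have "expect (list_pmf (replicate (Suc k) (arr n))) globs
      = expect (arr n) (\<lambda>t. (if t = Glob then 1 else 0) + k * (99 / 1000))"
    unfolding replicate_Suc by (subst expect_list_pmf_Cons) (simp_all only: fin_supp_simps globs_simps
        finite_arr[OF n] expect_add[OF fin] Suc expect_const)
  also have "\<dots> = 99 / 1000 + k * (99 / 1000)"
    by (subst expect_add) (simp_all add: one)
  finally show ?case by (simp add: algebra_simps)
qed simp

lemma expect_card_hit:
  assumes "\<And>j. j < n \<Longrightarrow> pmf (arr n) (c j) = a / (2 * n)" "0 \<le> a" "a \<le> 1"
  shows "expect (list_pmf (replicate (2 * n) (arr n))) (\<lambda>xs. card {j. j < n \<and> c j \<in> set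
      xs}) \<ge> n * (1 - exp (- a))"
proof -
  let ?P = "list_pmf (replicate (2 * n) (arr n))"
  have fin: "finite (set_pmf ?P)" by simp
  have card: "real (card {j. j < n \<and> c j \<in> set xs}) = real n - (\<Sum>j<n. if c j \<in> set xs
      then 0 else (1 :: real))" for xs
  proof -
    have "(\<Sum>j<n. if c j \<in> set xs then 1 else (0::real)) + (\<Sum>j<n. if c j \<in> set xs then 0
        else 1) = (\<Sum>j<n. 1)"
      by (subst sum.distrib[symmetric]) (intro sum.cong, auto)
    moreover have "(\<Sum>j<n. if c j \<in> set xs then 1 else (0::real)) = (\<Sum>j\<in>{j. j < n \<and>
        c j \<in> set xs}. 1)"
      by (intro sum.mono_neutral_cong_right) auto
    ultimately show ?thesis by simp
  qed
  have pow: "(1 - a / (2 * n)) ^ (2 * n) \<le> exp (- a)"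
  proof -
    have "a / (2 * n) \<le> 1" using assms n by (simp add: field_simps)
    then have "(1 - a / (2 * n)) ^ (2 * n) \<le> exp (- (a / (2 * n))) ^ (2 * n)"
      using exp_ge_add_one_self[of "- (a / (2 * n))"] by (intro power_mono) auto
    also have "\<dots> = exp (- a)" using n by (simp flip: exp_of_nat_mult)
    finally show ?thesis .
  qed
  have E: "expect ?P (\<lambda>xs. card {j. j < n \<and> c j \<in> set xs})
      = n - (\<Sum>j<n. expect ?P (\<lambda>xs. if c j \<in> set xs then 0 else 1))"
    unfolding card by (subst expect_diff) (simp_all add: expect_sum[OF fin])
  have "(\<Sum>j<n. expect ?P (\<lambda>xs. if c j \<in> set xs then 0 else 1)) = (\<Sum>j<n. (1 - a / (2
      * n)) ^ (2 * n))"
    by (intro sum.cong refl, subst expect_not_in_list) (use assms(1) in simp_all)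
  also have "\<dots> \<le> n * exp (- a)" using pow by (simp add: mult_left_mono)
  finally show ?thesis unfolding E by (simp only: right_diff_distrib mult_1_right diff_left_mono)
qed

end

lemma expect_opt_lower:
  fixes N :: nat
  defines "n \<equiv> N ^ 4"
  assumes N: "N \<ge> 1000000"
  shows "n * (20441 / 10000) \<le> expect (types_pmf (arrival_pmf (inst_I n) (inst_lam n) (2 * n)) (2 *
      n)) (opt_val (inst_E n) inst_w)"
proof -
  have N0: "N > 0" using N by simp
  then have n: "n > 0" by (simp add: n_def)
  note [simp] = finite_arr[OF n]
  let ?ps = "replicate (2 * n) (arr n)"
  let ?P = "list_pmf ?ps"
  have fs: "fin_supp ?ps" by simp
  then have fin: "finite (set_pmf ?P)" by simp
  define X where "X xs = unsat n xs - globs xs" for xs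
  \<comment> \<open>The share 0.198 of global arrivals exceeds the mean deficiency 0.1975 together
    with the errors 1/65536 and 46/N.\<close>
  have EX: "expect ?P X \<le> 0"
  proof -
    have "expect ?P X = mean_unsat n 0 (2 * n) - 2 * n * (99 / 1000)"
      unfolding X_def[abs_def] using fin expect_globs[OF n, of "2 * n"]
      by (simp add: expect_diff mean_unsat_def)
    also have "\<dots> \<le> n * (79 / 400 + 1 / 65536 + 46 / N) - 2 * n * (99 / 1000)"
      using mean_unsat_final[OF N0] by (simp flip: n_def)
    also have "\<dots> = n * (79 / 400 + 1 / 65536 + 46 / N - 198 / 1000)" by (simp add: algebra_simps)
    also have "\<dots> \<le> 0"
    proof (rule mult_nonneg_nonpos)
      have "46 / real N \<le> 46 / 1000000" using N by (intro divide_left_mono) auto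
      then show "79 / 400 + 1 / 65536 + 46 / N - 198 / 1000 \<le> (0 :: real)" by simp
    qed simp
    finally show ?thesis .
  qed
  \<comment> \<open>Replacing one arrival changes \<open>X\<close> by at most 2, one from the
    deficiency and one from the global count, so the variance is at most 8 N^4.\<close>
  define \<sigma> where "\<sigma> = 3 * real N ^ 2"
  have \<sigma>0: "\<sigma> > 0" using N0 by (simp add: \<sigma>_def)
  have "real (length ?ps) * 2\<^sup>2 \<le> \<sigma>\<^sup>2"
    by (simp add: \<sigma>_def n_def power_mult_distrib flip: power_mult)
  moreover have "\<bar>X (xs @ x # ys) - X (xs @ y # ys)\<bar> \<le> 2" for xs x y ys
    using unsat_change_one[OF n, of xs x ys y] by (auto simp: X_def)
  ultimately have dev: "expect ?P (\<lambda>xs. \<bar>X xs - expect ?P X\<bar>) \<le> \<sigma>"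
    using fs \<sigma>0 by (intro abs_deviation_list_pmf) auto
  \<comment> \<open>As the mean is not positive, the positive part is at most the absolute
    deviation.\<close>
  have "expect ?P (\<lambda>xs. max 0 (X xs)) \<le> expect ?P (\<lambda>xs. \<bar>X xs - expect ?P X\<bar>)"
    using EX by (intro expect_mono fin) auto
  with dev have pos: "expect ?P (\<lambda>xs. max 0 (X xs)) \<le> \<sigma>" by simp
  let ?cP = "\<lambda>xs. real (card {j. j < n \<and> Priv j \<in> set xs})"
  let ?cH = "\<lambda>xs. real (card {j. j < n \<and> High j \<in> set xs})"
  have P: "expect ?P ?cP \<ge> n * (221 / 1000)"
  proof -
    have "(\<Sum>i<4. (1 / 4 :: real) ^ i / fact i) \<le> exp (1 / 4)" by (rule exp_ge_partial_sum) simp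
    then have "1000 / 779 \<le> exp (1 / 4 :: real)" by (simp add: eval_nat_numeral fact_numeral)
    then have "221 / 1000 \<le> 1 - exp (- (1 / 4) :: real)" by (simp add: exp_minus field_simps)
    then have "n * (221 / 1000) \<le> n * (1 - exp (- (1 / 4) :: real))" by (intro mult_left_mono) auto
    moreover have "\<dots> \<le> expect ?P ?cP"
      using pmf_arr_Priv[OF n] by (intro expect_card_hit[OF n]) auto
    ultimately show ?thesis by linarith
  qed
  have H: "expect ?P ?cH \<ge> n * (1 / 100001)"
  proof -
    have "100001 / 100000 \<le> exp (1 / 100000 :: real)"
      using exp_ge_add_one_self[of "1 / 100000 :: real"] by simp
    then have "1 / 100001 \<le> 1 - exp (- (1 / 100000) :: real)" by (simp add: exp_minus field_simps)
    then have "n * (1 / 100001) \<le> n * (1 - exp (- (1 / 100000) :: real))" by (intro mult_left_mono) auto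
    moreover have "\<dots> \<le> expect ?P ?cH"
      using pmf_arr_High[OF n] by (intro expect_card_hit[OF n]) auto
    ultimately show ?thesis by linarith
  qed
  have small: "\<sigma> \<le> n * (1 / 100000)"
  proof -
    have "300000 \<le> real N ^ 2"
    proof -
      have "(1000000 :: real) ^ 1 \<le> real N ^ 1" using N by simp
      also have "\<dots> \<le> real N ^ 2" using N by (intro power_increasing) auto
      finally show ?thesis by simp
    qed
    then have "real N ^ 2 * 300000 \<le> real N ^ 2 * real N ^ 2" by (intro mult_left_mono) auto
    then show ?thesis by (simp add: \<sigma>_def n_def flip: power_add)
  qed
  have "n * (20441 / 10000) \<le> n - \<sigma> + n * (221 / 1000) / 5 + (highW - 6 / 5) * (n * (1 / 100001))"
    using small by (simp add: algebra_simps)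
  also have "\<dots> \<le> n - expect ?P (\<lambda>xs. max 0 (X xs)) + expect ?P ?cP / 5 + (highW - 6 /
      5) * expect ?P ?cH"
    using pos P H by (intro add_mono mult_left_mono diff_mono divide_right_mono) auto
  also have "\<dots> = expect ?P (\<lambda>xs. n - max 0 (X xs) + ?cP xs / 5 + (highW - 6 / 5) * ?cH xs)"
    using fin by (simp add: expect_add expect_diff)
  also have "\<dots> \<le> expect ?P (\<lambda>xs. opt_val (inst_E n) inst_w (map to_nat xs))"
    unfolding X_def using set_list_pmf_replicate by (intro expect_mono fin opt_val_lower[OF n]) blast
  also have "\<dots> = expect (types_pmf (arrival_pmf (inst_I n) (inst_lam n) (2 * n)) (2 * n)) (opt_val
      (inst_E n) inst_w)"
    by (simp add: arrival_pmf_inst[OF n] types_pmf_map)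
  finally show ?thesis .
qed

section \<open>Online algorithms\<close>

lemma inst_w_to_nat: "inst_w (to_nat t) j = wt t"
  by (simp add: inst_w_def)

lemma finite_run:
  assumes "finite (set_pmf p)" "\<And>h i. finite (set_pmf (A h i))"
  shows "finite (set_pmf (run A p k h))"
  using assms by (induction k arbitrary: h) auto

lemma alg_gain_snoc:
  "alg_gain w (h @ [(i, d)]) = alg_gain w h + (case d of None \<Rightarrow> 0 | Some j \<Rightarrow> w i j)"
  by (simp add: alg_gain_def)

lemma matched_offline_snoc:
  "matched_offline (h @ [(i, d)]) = matched_offline h \<union> set_option d"
  by (cases d) (auto simp: matched_offline_def)

text \<open>The Bellman inequality for the potential \<open>\<alpha> k * card S + \<beta> k\<close>,
  where \<open>S\<close> is the set of free vertices: an arrival is worth matching only for its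
  weight minus the price of the vertex it uses.\<close>

definition potential_step ::
  "nat \<Rightarrow> (nat \<Rightarrow> real) \<Rightarrow> (nat \<Rightarrow> real) \<Rightarrow> nat
      \<Rightarrow> bool" where
  "potential_step n \<alpha> \<beta> k \<longleftrightarrow> (\<forall>S. S \<subseteq> {..<n}
      \<longrightarrow>
     \<alpha> k * card S + \<beta> k + expect (arr n) (\<lambda>t. if nbr n t \<inter> S = {} then 0 else
         max 0 (wt t - \<alpha> k))
       \<le> \<alpha> (Suc k) * card S + \<beta> (Suc k))"

text \<open>A linear upper bound on the value of the free vertices: \<^term>\<open>\<alpha> k\<close> is
    the price of a free vertex
  when \<^term>\<open>k\<close> arrivals remain.\<close>

lemma run_le_potential:
  fixes \<alpha> \<beta> :: "nat \<Rightarrow> real"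
  assumes n: "n > 0" and A: "valid_alg (inst_E n) A"
    and nonneg: "\<alpha> 0 \<ge> 0" "\<beta> 0 \<ge> 0" and step: "\<And>k. k < K \<Longrightarrow>
        potential_step n \<alpha> \<beta> k"
  shows "k \<le> K \<Longrightarrow> expect (run A (map_pmf to_nat (arr n)) k h) (alg_gain inst_w)
    \<le> alg_gain inst_w h + \<alpha> k * card ({..<n} - matched_offline h) + \<beta> k"
proof (induction k arbitrary: h)
  case 0
  then show ?case using nonneg by simp
next
  case (Suc k)
  let ?p = "map_pmf to_nat (arr n)"
  let ?S = "{..<n} - matched_offline h"
  let ?g = "alg_gain inst_w h"
  note [simp] = finite_arr[OF n]
  have supp: "set_pmf (A h i) \<subseteq> insert None (Some ` {j. (i, j) \<in> inst_E n \<and> j \<notin>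
      matched_offline h})" for h i
    using A by (simp add: valid_alg_def)
  have finA: "finite (set_pmf (A h i))" for h i
  proof (rule finite_subset[OF supp])
    have "finite (snd ` inst_E n)" using finite_inst_E[OF n] by simp
    moreover have "{j. (i, j) \<in> inst_E n \<and> j \<notin> matched_offline h} \<subseteq> snd `
        inst_E n" by force
    ultimately have "finite {j. (i, j) \<in> inst_E n \<and> j \<notin> matched_offline h}" by (rule
        rev_finite_subset)
    then show "finite (insert None (Some ` {j. (i, j) \<in> inst_E n \<and> j \<notin> matched_offline
        h}))" by simp
  qed
  have fin_run: "finite (set_pmf (run A ?p k h))" for h
    by (rule finite_run) (simp_all add: finA)
  define gain where "gain t = (if nbr n t \<inter> ?S = {} then 0 else max 0 (wt t - \<alpha> k))" for t
  \<comment> \<open>A match collects the weight and removes one free vertex, priced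
    \<open>\<alpha> k\<close>; refusing collects nothing. Either way the profit is at most
    \<open>gain t\<close>.\<close>
  have decision: "expect (run A ?p k (h @ [(to_nat t, d)])) (alg_gain inst_w) \<le> ?g + \<alpha> k *
      card ?S + \<beta> k + gain t"
    if "t \<in> set_pmf (arr n)" "d \<in> set_pmf (A h (to_nat t))" for t d
  proof -
    have IH: "expect (run A ?p k (h @ [(to_nat t, d)])) (alg_gain inst_w) \<le>
        ?g + (case d of None \<Rightarrow> 0 | Some j \<Rightarrow> wt t)
        + \<alpha> k * card ({..<n} - (matched_offline h \<union> set_option d)) + \<beta> k"
      using Suc.IH[of "h @ [(to_nat t, d)]"] Suc.prems
      by (simp add: alg_gain_snoc matched_offline_snoc inst_w_to_nat split: option.splits)
    show ?thesis
    proof (cases d)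
      case None
      then show ?thesis using IH by (auto simp: gain_def)
    next
      case (Some j)
      then have "(to_nat t, j) \<in> inst_E n" "j \<notin> matched_offline h"
        using supp[of h "to_nat t"] that(2) by auto
      then have j: "j \<in> nbr n t" "j \<in> ?S"
        using set_arr[OF n] by (auto simp: inst_E_def)
      have "{..<n} - (matched_offline h \<union> set_option d) = ?S - {j}" using Some by auto
      moreover have "card ?S = Suc (card (?S - {j}))" using j(2) by (intro card.remove) auto
      ultimately have cd: "real (card ({..<n} - (matched_offline h \<union> set_option d))) = real (card
          ?S) - 1"
        by simp
      have "(case d of None \<Rightarrow> 0 | Some j \<Rightarrow> wt t) = wt t" using Some by simp
      note IH[unfolded cd this right_diff_distrib mult_1_right]
      moreover have "wt t - \<alpha> k \<le> gain t" using j by (auto simp: gain_def)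
      ultimately show ?thesis by linarith
    qed
  qed
  have "expect (run A ?p (Suc k) h) (alg_gain inst_w)
      = expect (arr n) (\<lambda>t. expect (A h (to_nat t)) (\<lambda>d. expect (run A ?p k (h @ [(to_nat
          t, d)])) (alg_gain inst_w)))"
    using finA fin_run by (simp add: expect_bind bind_map_pmf)
  also have "\<dots> \<le> expect (arr n) (\<lambda>t. ?g + \<alpha> k * card ?S + \<beta> k + gain t)"
  proof (rule expect_mono)
    fix t assume t: "t \<in> set_pmf (arr n)"
    have "expect (A h (to_nat t)) (\<lambda>d. expect (run A ?p k (h @ [(to_nat t, d)])) (alg_gain inst_w))
        \<le> expect (A h (to_nat t)) (\<lambda>d. ?g + \<alpha> k * card ?S + \<beta> k + gain t)"
      using decision[OF t] by (intro expect_mono finA)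
    then show "expect (A h (to_nat t)) (\<lambda>d. expect (run A ?p k (h @ [(to_nat t, d)])) (alg_gain
        inst_w))
        \<le> ?g + \<alpha> k * card ?S + \<beta> k + gain t" by simp
  qed simp
  also have "\<dots> = ?g + (\<alpha> k * card ?S + \<beta> k + expect (arr n) gain)"
    by (simp add: expect_add)
  also have "\<alpha> k * card ?S + \<beta> k + expect (arr n) gain \<le> \<alpha> (Suc k) * card ?S +
      \<beta> (Suc k)"
    using step[of k] Suc.prems unfolding potential_step_def gain_def[abs_def] by auto
  finally show ?case by simp
qed

text \<open>With x = 1 - y the difference of the two sides is (x - v)^2 (x + 2 v). The right side is
  the tangent at an occupied fraction \<open>v\<close>.\<close>

lemma triple_tangent:
  fixes v y :: real
  assumes "0 \<le> v" "y \<le> 1"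
  shows "1 - (1 - y) ^ 3 \<le> 1 - 3 * v\<^sup>2 + 2 * v ^ 3 + 3 * v\<^sup>2 * y"
proof -
  have "0 \<le> (1 - y - v)\<^sup>2 * (1 - y + 2 * v)" using assms by (intro mult_nonneg_nonneg) auto
  then show ?thesis by (simp add: power2_eq_square power3_eq_cube algebra_simps)
qed

text \<open>After the tangent bound, the expected profit is affine in the free fraction. Its slope
  is charged to the price in \<open>A\<close> and its constant term to the bonus in
  \<open>B\<close>; the rare arrivals contribute at most 1 to the former.\<close>

lemma potential_stepI:
  fixes n k :: nat and \<alpha> \<beta> :: "nat \<Rightarrow> real" and a a' b b' v :: real
  assumes n: "n > 0" and v: "0 \<le> v" and a: "0 \<le> a"
    and \<alpha>: "\<alpha> k = a" "\<alpha> (Suc k) = a'" and \<beta>: "\<beta> k = n * b" "\<beta> (Suc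
        k) = n * b'"
    and A: "a + 1 / (2 * n) * (1 + max 0 (6 / 5 - a) / 4 + 9 / 5 * v\<^sup>2 * max 0 (1 - a)) \<le> a'"
    and B: "b + 1 / (2 * n) * (max 0 (1 - a) * (198 / 1000 + 3 / 5 * (1 - 3 * v\<^sup>2 + 2 * v ^ 3)))
        \<le> b'"
  shows "potential_step n \<alpha> \<beta> k"
  unfolding potential_step_def
proof (intro allI impI)
  fix S assume S: "S \<subseteq> {..<n}"
  define y where "y = card S / n"
  have "card S \<le> n" using card_mono[OF _ S] by simp
  then have y: "0 \<le> y" "y \<le> 1" using n by (auto simp: y_def)
  have cS: "real (card S) = n * y" using n by (simp add: y_def)
  define p where "p = max 0 (6 / 5 - a)"
  define q where "q = max 0 (1 - a)"
  have q: "0 \<le> q" by (simp add: q_def)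
  have t1: "q * (3 / 10 * (1 - (1 - y) ^ 3) + (if S = {} then 0 else 99 / 1000))
      \<le> q * (3 / 10 * (1 - 3 * v\<^sup>2 + 2 * v ^ 3 + 3 * v\<^sup>2 * y) + 99 / 1000)"
    using triple_tangent[OF v y(2)] by (intro mult_left_mono q add_mono) auto
  have t2: "y * (max 0 (highW - a) / 200000 + p / 8) \<le> y * (1 / 2 + p / 8)"
    using y a by (intro mult_left_mono) auto
  have E: "expect (arr n) (\<lambda>t. if nbr n t \<inter> S = {} then 0 else max 0 (wt t - \<alpha> k))
      \<le> y * (1 / 2 + p / 8) + q * (3 / 10 * (1 - 3 * v\<^sup>2 + 2 * v ^ 3 + 3 * v\<^sup>2 * y) + 99
          / 1000)"
    unfolding \<alpha>(1) expect_arr_meets[OF n S, of "\<lambda>x. max 0 (x - a)", folded y_def, folded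
        p_def q_def]
    by (rule add_mono[OF t2 t1])
  have "(n * y) * (a + 1 / (2 * n) * (1 + p / 4 + 9 / 5 * v\<^sup>2 * q)) \<le> (n * y) * a'"
    using A y by (intro mult_left_mono) (auto simp: p_def q_def)
  moreover have "n * (b + 1 / (2 * n) * (q * (198 / 1000 + 3 / 5 * (1 - 3 * v\<^sup>2 + 2 * v ^ 3))))
      \<le> n * b'"
    using B by (intro mult_left_mono) (auto simp: q_def)
  moreover have "(n * y) * (a + 1 / (2 * n) * (1 + p / 4 + 9 / 5 * v\<^sup>2 * q))
      = n * y * a + y * (1 / 2 + p / 8) + 9 / 10 * v\<^sup>2 * q * y"
    using n by (simp add: field_simps)
  moreover have "n * (b + 1 / (2 * n) * (q * (198 / 1000 + 3 / 5 * (1 - 3 * v\<^sup>2 + 2 * v ^ 3))))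
      = n * b + q * (3 / 10 * (1 - 3 * v\<^sup>2 + 2 * v ^ 3) + 99 / 1000)"
    using n by (simp add: field_simps)
  moreover have "q * (3 / 10 * (1 - 3 * v\<^sup>2 + 2 * v ^ 3 + 3 * v\<^sup>2 * y) + 99 / 1000)
      = q * (3 / 10 * (1 - 3 * v\<^sup>2 + 2 * v ^ 3) + 99 / 1000) + 9 / 10 * v\<^sup>2 * q * y"
    by (simp add: algebra_simps)
  ultimately show "\<alpha> k * card S + \<beta> k + expect (arr n) (\<lambda>t. if nbr n t \<inter> S =
      {} then 0 else max 0 (wt t - \<alpha> k))
       \<le> \<alpha> (Suc k) * card S + \<beta> (Suc k)"
    using E unfolding \<alpha> \<beta> cS by (simp add: mult.commute)
qed

section \<open>Numerical estimates\<close>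

text \<open>\<^term>\<open>gap\<close> is a polynomial approximation, from below, to the solution of
  \<open>g' = - 21/20 - (1/4 + 9/5 v\<^sup>2) g\<close>, \<open>g(0) = 1\<close>, where \<open>v = occ
      s\<close> is the point of tangency (roughly the
  fraction of occupied vertices of an optimal algorithm), and \<^term>\<open>bonus0\<close> is the
      integral of the
  polynomial in \<open>bonus0_deriv_poly\<close>. The residual of \<^term>\<open>gap\<close> is positive
      because its Bernstein
  coefficients on each third of \<open>[0, 29/40]\<close> are.\<close>

definition gap :: "real \<Rightarrow> real" where
  "gap s = (399997 / 400000) - (10913 / 5000) * s + (90633 / 40000) * s ^ 2 - (506769 / 200000) * s ^ 3 +
      (32659 / 20000) * s ^ 4 - (47 / 100) * s ^ 5"

definition gap' :: "real \<Rightarrow> real" where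
  "gap' s = - (10913 / 5000) + (90633 / 20000) * s - (1520307 / 200000) * s ^ 2 + (32659 / 5000) * s ^ 3
      - (47 / 20) * s ^ 4"

definition bonus0 :: "real \<Rightarrow> real" where
  "bonus0 s = (327597543 / 1000000000) * s - (144849159 / 4000000000) * s ^ 2 - (93372261 / 2000000000) *
      s ^ 3 - (9971211759 / 32000000000) * s ^ 4 + (846927429 / 2500000000) * s ^ 5 - (2790058977 /
          8000000000) * s ^ 6 + (9659022651 / 28000000000) * s ^ 7 - (579158601 / 3200000000) * s ^ 8 +
              (230911 / 6000000) * s ^ 9"

definition occ :: "real \<Rightarrow> real" where
  "occ s = 7 / 10 - 17 / 20 * s"

lemma gap_residual_poly:
  "- gap' s - 21 / 20 - (1 / 4 + 9 / 5 * (occ s)\<^sup>2) * gap s - 1 / 2000 = (10849 / 100000000) +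
      (16207427 / 200000000) * s - (751198677 / 800000000) * s ^ 2 + (402838099 / 100000000) * s ^ 3 -
          (3149080321 / 400000000) * s ^ 4 + (2930033729 / 400000000) * s ^ 5 - (125215659 / 40000000) *
              s ^ 6 + (122247 / 200000) * s ^ 7"
  unfolding gap_def gap'_def occ_def by algebra

lemma bonus0_deriv_poly:
  "gap s * (198 / 1000 + 3 / 5 * (1 - 3 * (occ s)\<^sup>2 + 2 * occ s ^ 3)) = (327597543 / 1000000000) -
      (144849159 / 2000000000) * s - (280116783 / 2000000000) * s ^ 2 - (9971211759 / 8000000000) * s ^ 3
          + (846927429 / 500000000) * s ^ 4 - (8370176931 / 4000000000) * s ^ 5 + (9659022651 /
              4000000000) * s ^ 6 - (579158601 / 400000000) * s ^ 7 + (692733 / 2000000) * s ^ 8"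
  unfolding gap_def occ_def by algebra

lemma gap_residual_0:
  fixes s :: real
  assumes "0 \<le> s" "s \<le> 29 / 120"
  shows "0 \<le> (10849 / 100000000) + (16207427 / 200000000) * s - (751198677 / 800000000) * s ^ 2 +
      (402838099 / 100000000) * s ^ 3 - (3149080321 / 400000000) * s ^ 4 + (2930033729 / 400000000) * s ^
          5 - (125215659 / 40000000) * s ^ 6 + (122247 / 200000) * s ^ 7"
proof -
  \<comment> \<open>The products are the Bernstein basis of degree 7 on this interval, with scaling
    and binomial coefficients absorbed in the positive constants.\<close>
  have "0 \<le> 4319325388800000 * ((120 * s) ^ 0 * (29 - 120 * s) ^ 7) + 809934396272640000 * ((120 * s)
      ^ 1 * (29 - 120 * s) ^ 6) + 2585544594565248000 * ((120 * s) ^ 2 * (29 - 120 * s) ^ 5) +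
          3193521575900774400 * ((120 * s) ^ 3 * (29 - 120 * s) ^ 4) + 1897055249107161120 * ((120 * s) ^
              4 * (29 - 120 * s) ^ 3) + 567565560206695444 * ((120 * s) ^ 5 * (29 - 120 * s) ^ 2) +
                  94872739073810615 * ((120 * s) ^ 6 * (29 - 120 * s) ^ 1) + 11941901104435626 * ((120 *
                      s) ^ 7 * (29 - 120 * s) ^ 0)"
    using assms by (intro add_nonneg_nonneg mult_nonneg_nonneg zero_le_power) simp_all
  also have "\<dots> = 686771395475374080000000000000 * ((10849 / 100000000) + (16207427 / 200000000) * s
      - (751198677 / 800000000) * s ^ 2 + (402838099 / 100000000) * s ^ 3 - (3149080321 / 400000000) * s
          ^ 4 + (2930033729 / 400000000) * s ^ 5 - (125215659 / 40000000) * s ^ 6 + (122247 / 200000) * s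
              ^ 7)"
    by algebra
  finally show ?thesis by (simp only: zero_le_mult_iff) simp
qed

lemma gap_residual_1:
  fixes s :: real
  assumes "29 / 120 \<le> s" "s \<le> 29 / 60"
  shows "0 \<le> (10849 / 100000000) + (16207427 / 200000000) * s - (751198677 / 800000000) * s ^ 2 +
      (402838099 / 100000000) * s ^ 3 - (3149080321 / 400000000) * s ^ 4 + (2930033729 / 400000000) * s ^
          5 - (125215659 / 40000000) * s ^ 6 + (122247 / 200000) * s ^ 7"
proof -
  have "0 \<le> 11941901104435626 * ((120 * s - 29) ^ 0 * (58 - 120 * s) ^ 7) + 72313876388288149 * ((120
      * s - 29) ^ 1 * (58 - 120 * s) ^ 6) + 432212384093560648 * ((120 * s - 29) ^ 2 * (58 - 120 * s) ^
          5) + 1429968317773131700 * ((120 * s - 29) ^ 3 * (58 - 120 * s) ^ 4) + 2227528357985555360 *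
              ((120 * s - 29) ^ 4 * (58 - 120 * s) ^ 3) + 1707003863269360112 * ((120 * s - 29) ^ 5 * (58
                  - 120 * s) ^ 2) + 623897566542942848 * ((120 * s - 29) ^ 6 * (58 - 120 * s) ^ 1) +
                      87465677645240256 * ((120 * s - 29) ^ 7 * (58 - 120 * s) ^ 0)"
    using assms by (intro add_nonneg_nonneg mult_nonneg_nonneg zero_le_power) simp_all
  also have "\<dots> = 686771395475374080000000000000 * ((10849 / 100000000) + (16207427 / 200000000) * s
      - (751198677 / 800000000) * s ^ 2 + (402838099 / 100000000) * s ^ 3 - (3149080321 / 400000000) * s
          ^ 4 + (2930033729 / 400000000) * s ^ 5 - (125215659 / 40000000) * s ^ 6 + (122247 / 200000) * s
              ^ 7)"
    by algebra
  finally show ?thesis by (simp only: zero_le_mult_iff) simp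
qed

lemma gap_residual_2:
  fixes s :: real
  assumes "29 / 60 \<le> s" "s \<le> 29 / 40"
  shows "0 \<le> (10849 / 100000000) + (16207427 / 200000000) * s - (751198677 / 800000000) * s ^ 2 +
      (402838099 / 100000000) * s ^ 3 - (3149080321 / 400000000) * s ^ 4 + (2930033729 / 400000000) * s ^
          5 - (125215659 / 40000000) * s ^ 6 + (122247 / 200000) * s ^ 7"
proof -
  have "0 \<le> 87465677645240256 * ((120 * s - 58) ^ 0 * (87 - 120 * s) ^ 7) + 600621920490420736 *
      ((120 * s - 58) ^ 1 * (87 - 120 * s) ^ 6) + 1567349986954227440 * ((120 * s - 58) ^ 2 * (87 - 120 *
          s) ^ 5) + 1899046022798746560 * ((120 * s - 58) ^ 3 * (87 - 120 * s) ^ 4) + 1047064819126780980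
              * ((120 * s - 58) ^ 4 * (87 - 120 * s) ^ 3) + 288745399735878384 * ((120 * s - 58) ^ 5 *
                  (87 - 120 * s) ^ 2) + 178776568125271269 * ((120 * s - 58) ^ 6 * (87 - 120 * s) ^ 1) +
                      93415234176000000 * ((120 * s - 58) ^ 7 * (87 - 120 * s) ^ 0)"
    using assms by (intro add_nonneg_nonneg mult_nonneg_nonneg zero_le_power) simp_all
  also have "\<dots> = 686771395475374080000000000000 * ((10849 / 100000000) + (16207427 / 200000000) * s
      - (751198677 / 800000000) * s ^ 2 + (402838099 / 100000000) * s ^ 3 - (3149080321 / 400000000) * s
          ^ 4 + (2930033729 / 400000000) * s ^ 5 - (125215659 / 40000000) * s ^ 6 + (122247 / 200000) * s
              ^ 7)"
    by algebra
  finally show ?thesis by (simp only: zero_le_mult_iff) simp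
qed

text \<open>The lower bound on the second derivative is integrated twice, crudely: on the whole
  interval the first derivative is at least \<open>f' s - C * h\<close>.\<close>

lemma taylor_lower:
  fixes f f' f'' :: "real \<Rightarrow> real"
  assumes "0 \<le> h" and "\<And>x. s \<le> x \<Longrightarrow> x \<le> s + h \<Longrightarrow> (f
      has_real_derivative f' x) (at x)"
    and "\<And>x. s \<le> x \<Longrightarrow> x \<le> s + h \<Longrightarrow> (f' has_real_derivative f''
        x) (at x)"
    and "\<And>x. s \<le> x \<Longrightarrow> x \<le> s + h \<Longrightarrow> - C \<le> f'' x" and "0 \<le> C"
  shows "f s + h * f' s - C * h\<^sup>2 \<le> f (s + h)"
proof -
  have f'_ge: "f' s - C * h \<le> f' x" if x: "s \<le> x" "x \<le> s + h" for x
  proof -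
    have "f' s + C * s \<le> f' x + C * x"
    proof (rule DERIV_nonneg_imp_nondecreasing[OF x(1)])
      fix z assume z: "s \<le> z" "z \<le> x"
      have "((\<lambda>z. f' z + C * z) has_real_derivative (f'' z + C)) (at z)"
        using assms(3)[of z] z x by (auto intro!: derivative_eq_intros)
      moreover have "0 \<le> f'' z + C" using assms(4)[of z] z x by simp
      ultimately show "\<exists>y. ((\<lambda>z. f' z + C * z) has_real_derivative y) (at z) \<and> y
          \<ge> 0" by blast
    qed
    moreover have "C * (x - s) \<le> C * h" using x assms(5) by (intro mult_left_mono) auto
    ultimately show ?thesis by (simp add: algebra_simps)
  qed
  have "f s - (f' s - C * h) * s \<le> f (s + h) - (f' s - C * h) * (s + h)"
  proof (rule DERIV_nonneg_imp_nondecreasing[of s "s + h"])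
    fix z assume z: "s \<le> z" "z \<le> s + h"
    have "((\<lambda>z. f z - (f' s - C * h) * z) has_real_derivative (f' z - (f' s - C * h))) (at z)"
      using assms(2)[of z] z by (auto intro!: derivative_eq_intros)
    moreover have "0 \<le> f' z - (f' s - C * h)" using f'_ge[of z] z by simp
    ultimately show "\<exists>y. ((\<lambda>z. f z - (f' s - C * h) * z) has_real_derivative y) (at z)
        \<and> y \<ge> 0" by blast
  qed (use assms(1) in simp)
  then show ?thesis by (simp add: algebra_simps power2_eq_square)
qed

lemma gap_residual:
  assumes "0 \<le> s" "s \<le> 29 / 40"
  shows "21 / 20 + (1 / 4 + 9 / 5 * (occ s)\<^sup>2) * gap s + 1 / 2000 \<le> - gap' s"
proof -
  consider "s \<le> 29 / 120" | "29 / 120 \<le> s" "s \<le> 29 / 60" | "29 / 60 \<le> s" by linarith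
  then have "0 \<le> - gap' s - 21 / 20 - (1 / 4 + 9 / 5 * (occ s)\<^sup>2) * gap s - 1 / 2000"
    unfolding gap_residual_poly
    by cases (use gap_residual_0 gap_residual_1 gap_residual_2 assms in blast)+
  then show ?thesis by linarith
qed

lemma gap_step:
  assumes "0 \<le> s" "0 \<le> h" "s + h \<le> 29 / 40" "h \<le> 1 / 1000000"
  shows "1 - gap s + h * (21 / 20 + (1 / 4 + 9 / 5 * (occ s)\<^sup>2) * gap s) \<le> 1 - gap (s + h)"
proof -
  let ?g = "\<lambda>s. - ((90633 / 20000) - (1520307 / 100000) * s + (97977 / 5000) * s ^ 2 - (47 / 5) *
      s ^ 3) :: real"
  have "- gap s + h * (- gap' s) - 25 * h\<^sup>2 \<le> - gap (s + h)"
  proof (rule taylor_lower)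
    fix x assume x: "s \<le> x" "x \<le> s + h"
    then have x01: "0 \<le> x" "x \<le> 1" using assms by auto
    show "((\<lambda>s. - gap s) has_real_derivative - gap' x) (at x)"
      unfolding gap_def gap'_def by (auto intro!: derivative_eq_intros)
    show "((\<lambda>s. - gap' s) has_real_derivative ?g x) (at x)"
      unfolding gap'_def by (auto intro!: derivative_eq_intros)
    have "0 \<le> x ^ k" "x ^ k \<le> 1" for k using x01 by (auto intro: power_le_one)
    from this[of 2] this[of 3] x01 show "- 25 \<le> ?g x" by linarith
  qed (use assms in auto)
  moreover have "h * (21 / 20 + (1 / 4 + 9 / 5 * (occ s)\<^sup>2) * gap s + 1 / 2000) \<le> h * (- gap' s)"
    using assms by (intro mult_left_mono gap_residual) auto
  \<comment> \<open>The slack 1/2000 built into \<open>gap_residual\<close> pays for the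
    discretisation error.\<close>
  moreover have "25 * h\<^sup>2 \<le> h * (1 / 2000)"
    using mult_left_mono[of h "1 / 1000000" h] assms by (simp add: power2_eq_square)
  moreover have "h * (21 / 20 + (1 / 4 + 9 / 5 * (occ s)\<^sup>2) * gap s + 1 / 2000)
      = h * (21 / 20 + (1 / 4 + 9 / 5 * (occ s)\<^sup>2) * gap s) + h * (1 / 2000)"
    by (rule distrib_left)
  ultimately show ?thesis by linarith
qed

lemma bonus0_step:
  assumes "0 \<le> s" "0 \<le> h" "s + h \<le> 29 / 40" "h \<le> 1 / 1000000"
  shows "bonus0 s + s / 10000 + h * (gap s * (198 / 1000 + 3 / 5 * (1 - 3 * (occ s)\<^sup>2 + 2 * occ s ^ 3)))
    \<le> bonus0 (s + h) + (s + h) / 10000"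
proof -
  let ?d = "\<lambda>s. (327597543 / 1000000000) - (144849159 / 2000000000) * s - (280116783 /
      2000000000) * s ^ 2 - (9971211759 / 8000000000) * s ^ 3 + (846927429 / 500000000) * s ^ 4 -
          (8370176931 / 4000000000) * s ^ 5 + (9659022651 / 4000000000) * s ^ 6 - (579158601 / 400000000)
              * s ^ 7 + (692733 / 2000000) * s ^ 8 :: real" and ?e = "\<lambda>s. - (144849159 /
                  2000000000) - (280116783 / 1000000000) * s - (29913635277 / 8000000000) * s ^ 2 +
                      (846927429 / 125000000) * s ^ 3 - (8370176931 / 800000000) * s ^ 4 + (28977067953 /
                          2000000000) * s ^ 5 - (4054110207 / 400000000) * s ^ 6 + (692733 / 250000) * s
                              ^ 7 :: real"
  have "bonus0 s + h * ?d s - 25 * h\<^sup>2 \<le> bonus0 (s + h)"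
  proof (rule taylor_lower)
    fix x assume x: "s \<le> x" "x \<le> s + h"
    then have x01: "0 \<le> x" "x \<le> 1" using assms by auto
    show "(bonus0 has_real_derivative ?d x) (at x)"
      unfolding bonus0_def[abs_def] by (auto intro!: derivative_eq_intros)
    show "(?d has_real_derivative ?e x) (at x)"
      by (auto intro!: derivative_eq_intros)
    have "0 \<le> x ^ k" "x ^ k \<le> 1" for k using x01 by (auto intro: power_le_one)
    from this[of 2] this[of 3] this[of 4] this[of 5] this[of 6] this[of 7] x01
    show "- 25 \<le> ?e x" by linarith
  qed (use assms in auto)
  \<comment> \<open>The extra slope 1/10000 of the bonus pays for the discretisation error.\<close>
  moreover have "25 * h\<^sup>2 \<le> h / 10000"
    using mult_left_mono[of h "1 / 1000000" h] assms by (simp add: power2_eq_square)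
  ultimately show ?thesis unfolding bonus0_deriv_poly by argo
qed

text \<open>This exhibits the root 29/40, where the price reaches 1, the weight of triples and
  global arrivals.\<close>

lemma gap_factor:
  "gap s = (29 / 40 - s) * (13793 / 10000 - 1108 / 1000 * s + s\<^sup>2 * (1597 / 1000 - 12922 / 10000 *
      s) + 47 / 100 * s ^ 4)"
  unfolding gap_def by algebra

lemma gap_nonneg:
  assumes "0 \<le> s" "s \<le> 29 / 40"
  shows "0 \<le> gap s"
  unfolding gap_factor using assms
  by (intro mult_nonneg_nonneg add_nonneg_nonneg zero_le_power) auto

lemma gap_le_1:
  assumes "0 \<le> s" "s \<le> 29 / 40"
  shows "gap s \<le> 1"
proof -
  have "gap s + s * (10913 / 5000 - 90633 / 40000 * s + s\<^sup>2 * (506769 / 200000 - 32659 / 20000 * s)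
      + 47 / 100 * s ^ 4) = 399997 / 400000"
    unfolding gap_def by algebra
  moreover have "0 \<le> s * (10913 / 5000 - 90633 / 40000 * s + s\<^sup>2 * (506769 / 200000 - 32659 /
      20000 * s) + 47 / 100 * s ^ 4)"
    using assms by (intro mult_nonneg_nonneg add_nonneg_nonneg zero_le_power) auto
  ultimately show ?thesis by linarith
qed

text \<open>The three pieces of the price function correspond to the ranges in which all types, only
  private and rare types, and only rare types are worth more than a free vertex.\<close>

definition price :: "real \<Rightarrow> real" where
  "price s = (if s \<le> 29 / 40 then 1 - gap s
     else if s \<le> 37 / 40 then 1 + 10501 / 10000 * (s - 29 / 40) - (s - 29 / 40)\<^sup>2 / 8
     else s + 14001 / 50000)"

definition bonus :: "real \<Rightarrow> real" where
  "bonus s = (if s \<le> 29 / 40 then bonus0 s + s / 10000 else bonus0 (29 / 40) + 29 / 400000)"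

lemma price_middle:
  "29 / 40 \<le> s \<Longrightarrow> s \<le> 37 / 40 \<Longrightarrow> price s = 1 + 10501 / 10000 * (s -
      29 / 40) - (s - 29 / 40)\<^sup>2 / 8"
proof (cases "s = 29 / 40")
  case True
  show ?thesis unfolding True by (simp add: price_def gap_factor)
qed (auto simp: price_def)

text \<open>The constant 14001/50000 makes the last two pieces agree at 37/40, where the price
  slightly exceeds 6/5.\<close>

lemma price_late: "37 / 40 \<le> s \<Longrightarrow> price s = s + 14001 / 50000"
proof (cases "s = 37 / 40")
  case True
  show ?thesis unfolding True by (simp add: price_def power2_eq_square)
qed (auto simp: price_def)

lemma bonus_late: "29 / 40 \<le> s \<Longrightarrow> bonus s = bonus0 (29 / 40) + 29 / 400000"
proof (cases "s = 29 / 40")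
  case True
  show ?thesis unfolding True by (simp add: bonus_def)
qed (auto simp: bonus_def)

lemma price_bonus_final: "price 1 + bonus 1 \<le> 14366 / 10000"
  by (simp add: price_late bonus_late bonus0_def power_divide)

text \<open>As \<open>n\<close> is a multiple of 20, the breakpoints 29/40 and 37/40 are reached
  after exactly \<open>29 * M\<close> and \<open>37 * M\<close> arrivals, so no step straddles two
  pieces. The bound on \<open>M\<close> makes the step \<open>h\<close> at most 10^-6.\<close>

lemma potential_step_price:
  fixes M k :: nat
  defines "n \<equiv> 20 * M"
  assumes M: "M \<ge> 50000" and k: "k < 2 * n"
  shows "potential_step n (\<lambda>k. price (real k / (2 * real n))) (\<lambda>k. real n * bonus (real k
      / (2 * real n))) k"
proof -
  have n: "n > 0" using M by (simp add: n_def)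
  define s where "s = real k / (2 * real n)"
  define h where "h = 1 / (2 * real n)"
  have nM: "real n = 20 * real M" by (simp add: n_def)
  have s0: "0 \<le> s" by (simp add: s_def)
  have h: "0 \<le> h" "h \<le> 1 / 1000000" using M by (auto simp: h_def nM field_simps)
  have suc: "real (Suc k) / (2 * real n) = s + h" by (simp add: s_def h_def add_divide_distrib)
  have k_eq: "real k = 40 * real M * s" "real (Suc k) = 40 * real M * (s + h)"
    using n M by (simp_all add: s_def h_def nM field_simps)
  have le: "x \<le> c / 40" if "40 * real M * x \<le> c * real M" for x c
  proof -
    have "real M * (40 * x) \<le> real M * c" using that by (simp only: mult_ac)
    then have "40 * x \<le> c" using M by (subst (asm) mult_le_cancel_left_pos) auto
    then show ?thesis by simp
  qed
  have ge: "c / 40 \<le> x" if "c * real M \<le> 40 * real M * x" for x c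
  proof -
    have "real M * c \<le> real M * (40 * x)" using that by (simp only: mult_ac)
    then have "c \<le> 40 * x" using M by (subst (asm) mult_le_cancel_left_pos) auto
    then show ?thesis by simp
  qed
  have step: "potential_step n (\<lambda>k. price (real k / (2 * real n))) (\<lambda>k. real n * bonus
      (real k / (2 * real n))) k"
    if "0 \<le> v" "0 \<le> price s"
      "price s + h * (1 + max 0 (6 / 5 - price s) / 4 + 9 / 5 * v\<^sup>2 * max 0 (1 - price s)) \<le>
          price (s + h)"
      "bonus s + h * (max 0 (1 - price s) * (198 / 1000 + 3 / 5 * (1 - 3 * v\<^sup>2 + 2 * v ^ 3))) \<le>
          bonus (s + h)"
    for v
    using that n suc by (intro potential_stepI[of n v "price s" _ k "price (s + h)" _ "bonus s" "bonus (s
        + h)"])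
      (simp_all add: s_def h_def)
  consider "k < 29 * M" | "29 * M \<le> k" "k < 37 * M" | "37 * M \<le> k" by linarith
  then show ?thesis
  proof cases
    case 1
    then have "real (Suc k) \<le> 29 * real M" by linarith
    then have sh: "s + h \<le> 29 / 40" unfolding k_eq by (rule le)
    then have s1: "s \<le> 29 / 40" using h by simp
    note g = gap_nonneg[OF s0 s1] gap_le_1[OF s0 s1]
    have p: "price s = 1 - gap s" "price (s + h) = 1 - gap (s + h)"
      "bonus s = bonus0 s + s / 10000" "bonus (s + h) = bonus0 (s + h) + (s + h) / 10000"
      using s1 sh by (simp_all add: price_def bonus_def)
    have mx: "max 0 (6 / 5 - price s) = 1 / 5 + gap s" "max 0 (1 - price s) = gap s"
      using g by (simp_all add: p)
    show ?thesis
    proof (rule step[of "occ s"])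
      show "0 \<le> occ s" using s1 by (simp add: occ_def)
      show "0 \<le> price s" using g by (simp add: p)
      have e: "1 + (1 / 5 + gap s) / 4 + 9 / 5 * (occ s)\<^sup>2 * gap s = 21 / 20 + (1 / 4 + 9 / 5 *
          (occ s)\<^sup>2) * gap s"
        by (simp add: distrib_right add_divide_distrib)
      show "price s + h * (1 + max 0 (6 / 5 - price s) / 4 + 9 / 5 * (occ s)\<^sup>2 * max 0 (1 - price
          s)) \<le> price (s + h)"
        unfolding mx e unfolding p by (rule gap_step[OF s0 h(1) sh h(2)])
      show "bonus s + h * (max 0 (1 - price s) * (198 / 1000 + 3 / 5 * (1 - 3 * (occ s)\<^sup>2 + 2 * occ
          s ^ 3))) \<le> bonus (s + h)"
        unfolding mx unfolding p by (rule bonus0_step[OF s0 h(1) sh h(2)])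
    qed
  next
    case 2
    then have "real (Suc k) \<le> 37 * real M" by linarith
    then have sh: "s + h \<le> 37 / 40" unfolding k_eq by (rule le)
    have "29 * real M \<le> real k" using 2 by linarith
    then have s1: "29 / 40 \<le> s" unfolding k_eq by (rule ge)
    define \<tau> where "\<tau> = s - 29 / 40"
    have \<tau>: "0 \<le> \<tau>" "\<tau> + h \<le> 1 / 5" using s1 sh by (auto simp: \<tau>_def)
    have p: "price s = 1 + 10501 / 10000 * \<tau> - \<tau>\<^sup>2 / 8"
      "price (s + h) = 1 + 10501 / 10000 * (\<tau> + h) - (\<tau> + h)\<^sup>2 / 8"
      using s1 sh h by (simp_all add: price_middle \<tau>_def algebra_simps)
    have b: "bonus (s + h) = bonus s" using s1 h by (simp add: bonus_late)
    have sq: "\<tau>\<^sup>2 \<le> \<tau> / 5" using mult_left_mono[of \<tau> "1 / 5" \<tau>] \<tau> h by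
        (simp add: power2_eq_square)
    have p1: "1 \<le> price s" using sq \<tau> by (simp add: p)
    have "6 / 5 - price s \<le> 4 * (501 / 10000 - \<tau> / 4 - h / 8)"
      using sq \<tau> h unfolding p by argo
    moreover have "0 \<le> 501 / 10000 - \<tau> / 4 - h / 8" using \<tau> h by argo
    \<comment> \<open>The term h/8 comes from the exact increment of the quadratic piece over one
      step.\<close>
    ultimately have mx: "max 0 (6 / 5 - price s) / 4 \<le> 501 / 10000 - \<tau> / 4 - h / 8"
      by (simp add: max_def)
    have "h * (1 + max 0 (6 / 5 - price s) / 4) \<le> h * (1 + (501 / 10000 - \<tau> / 4 - h / 8))"
      by (rule mult_left_mono[OF add_left_mono[OF mx] h(1)])
    also have "\<dots> = price (s + h) - price s"
      unfolding p by (simp add: power2_eq_square add_divide_distrib algebra_simps)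
    finally show ?thesis
      \<comment> \<open>The price is at least 1, so triples and global arrivals yield no profit and
        any point of tangency will do.\<close>
      using p1 b by (intro step[of 0]) auto
  next
    case 3
    then have "37 * real M \<le> real k" by linarith
    then have s1: "37 / 40 \<le> s" unfolding k_eq by (rule ge)
    have p: "price s = s + 14001 / 50000" "price (s + h) = s + h + 14001 / 50000"
      using s1 h by (simp_all add: price_late)
    have b: "bonus (s + h) = bonus s" using s1 h by (simp add: bonus_late)
    show ?thesis
      using s1 s0 b p by (intro step[of 0]) auto
  qed
qed

section \<open>Comparison of the online and offline values\<close>

theorem mainTheorem17:
  shows "\<exists>I J E w lam Lambda.
     valid_instance I J E w lam Lambda \<and>
     (\<forall>A. valid_alg E A \<longrightarrow>
        measure_pmf.expectation (run A (arrival_pmf I lam Lambda) Lambda []) (alg_gain w)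
        < (703 / 1000) *
          measure_pmf.expectation (types_pmf (arrival_pmf I lam Lambda) Lambda) (opt_val E w))"
proof -
  \<comment> \<open>This \<open>N\<close> meets the requirement of \<open>expect_opt_lower\<close>
    and makes \<open>N ^ 4\<close> a multiple of 20, as the breakpoints of the price
    require.\<close>
  obtain N :: nat where N: "N = 1000000" by blast
  define n where "n = N ^ 4"
  have n: "n > 0" using N by (simp add: n_def)
  have nM: "n = 20 * (N ^ 3 * 50000)" using N by (simp add: n_def)
  have M: "N ^ 3 * 50000 \<ge> 50000" using N by simp
  let ?p = "arrival_pmf (inst_I n) (inst_lam n) (2 * n)"
  have opt: "n * (20441 / 10000) \<le> expect (types_pmf ?p (2 * n)) (opt_val (inst_E n) inst_w)"
    unfolding n_def using N by (intro expect_opt_lower) simp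
  have alg: "expect (run A ?p (2 * n) []) (alg_gain inst_w) < 703 / 1000 *
      expect (types_pmf ?p (2 * n)) (opt_val (inst_E n) inst_w)" if A: "valid_alg (inst_E n) A" for A
  proof -
    have step: "potential_step n (\<lambda>k. price (real k / (2 * real n))) (\<lambda>k. real n * bonus
        (real k / (2 * real n))) k" if "k < 2 * n" for k
      using potential_step_price[OF M, of k] that unfolding nM[symmetric] .
    have "expect (run A (map_pmf to_nat (arr n)) (2 * n) []) (alg_gain inst_w)
        \<le> alg_gain inst_w [] + price (real (2 * n) / (2 * real n)) * card ({..<n} - matched_offline [])
          + real n * bonus (real (2 * n) / (2 * real n))"
      by (rule run_le_potential[where K = "2 * n", OF n A _ _ step order_refl])
        (simp_all add: price_def bonus_def gap_def bonus0_def)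
    also have "\<dots> = n * (price 1 + bonus 1)"
      using n by (simp add: alg_gain_def matched_offline_def algebra_simps)
    also have "\<dots> \<le> n * (14366 / 10000)"
      using price_bonus_final by (intro mult_left_mono) auto
    \<comment> \<open>The strict margin: 0.703 * 2.0441 is just above 1.4370, against 1.4366
      online.\<close>
    also have "\<dots> < 703 / 1000 * (n * (20441 / 10000))" using n by simp
    also have "\<dots> \<le> 703 / 1000 * expect (types_pmf ?p (2 * n)) (opt_val (inst_E n) inst_w)"
      using opt by (intro mult_left_mono) auto
    finally show ?thesis unfolding arrival_pmf_inst[OF n] .
  qed
  show ?thesis
    by (intro exI conjI allI impI) (rule valid_inst[OF n], rule alg)
qed

end
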